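(* Let $d\ge2$ and let $\mathcal{D}$ be a system of dyadic cubes in $\mathbb{R}^d$. If $U\subseteq\mathbb{R}^d$ is open, bounded, and of finite perimeter, then there exist an at most countable family $\{Q_j\}_{j}\subseteq\mathcal{D}$ and a constant $C>0$ such that $$\chi_U=\sum_{j}\chi_{U\cap Q_j}$$ and $$\ell(Q_j)^{d-1}\le C\,|D\chi_U|(Q_j)$$ for all $j$.
   Context: $\chi_E$ is the indicator function of $E$. A measurable set $U\subset\mathbb{R}^d$ has finite perimeter if the distributional gradient $D\chi_U$ is a finite $\mathbb{R}^d$-valued Radon measure on $\mathbb{R}^d$; $|D\chi_U|$ is its total variation measure. $\ell(Q)$ is the side length of the cube $Q$. A system of dyadic cubes is a collection $\mathcal{D}=\bigcup_{k\in\mathbb{Z}}\mathcal{D}_k$ of half-open axis-parallel cubes, where each $\mathcal{D}_k$ is a partition of $\mathbb{R}^d$ into cubes of side length $2^{k}$ and each cube of $\mathcal{D}_k$ is the union of $2^d$ cubes of $\mathcal{D}_{k-1}$ (for instance the standard dyadic cubes). *)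

theory Defs
  imports "HOL-Analysis.Analysis"
begin

definition partial_deriv :: "'d::finite \<Rightarrow> (real^'d \<Rightarrow> real) \<Rightarrow> real^'d \<Rightarrow> real" where
  "partial_deriv i f x = frechet_derivative f (at x) (axis i 1)"

primrec cont_diff :: "nat \<Rightarrow> (real^'d::finite \<Rightarrow> real) \<Rightarrow> bool" where
  "cont_diff 0 f \<longleftrightarrow> continuous_on UNIV f"
| "cont_diff (Suc k) f \<longleftrightarrow>
     f differentiable_on UNIV \<and> (\<forall>i. cont_diff k (partial_deriv i f))"

definition test_function :: "(real^'d::finite \<Rightarrow> real) \<Rightarrow> bool" where
  "test_function \<phi> \<longleftrightarrow> (\<forall>k. cont_diff k \<phi>) \<and> compact (closure {x. \<phi> x \<noteq> 0})"

text \<open>The total variation of a Borel set function, as the supremum over countable Borel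
  partitions. Only its values on Borel sets are meaningful.\<close>

definition total_variation ::
    "('a::topological_space set \<Rightarrow> 'b::real_normed_vector) \<Rightarrow> 'a set \<Rightarrow> ennreal" where
  "total_variation \<mu> A =
     (SUP E \<in> {E :: nat \<Rightarrow> 'a set. range E \<subseteq> sets borel \<and> disjoint_family E \<and> (\<Union>n. E n) = A}.
        (\<Sum>n. ennreal (norm (\<mu> (E n)))))"

text \<open>Finite vector-valued Borel measures. On \<open>real^'d\<close> a finite Borel measure is automatically
  Radon, so regularity is not an extra condition.\<close>

definition finite_vector_measure ::
    "('a::topological_space set \<Rightarrow> 'b::real_normed_vector) \<Rightarrow> bool" where
  "finite_vector_measure \<mu> \<longleftrightarrow>
     \<mu> {} = 0 \<and>
     (\<forall>E :: nat \<Rightarrow> 'a set. range E \<subseteq> sets borel \<longrightarrow> disjoint_family E \<longrightarrow>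
        (\<lambda>n. \<mu> (E n)) sums \<mu> (\<Union>n. E n)) \<and>
     total_variation \<mu> UNIV < \<infinity>"

text \<open>The integral against a finite signed measure is taken through its Jordan decomposition
  into the upper variation of \<open>m\<close> and that of \<open>- m\<close>. Negative values are cut off by
  \<^const>\<open>ennreal\<close>, which does not change the supremum since \<open>m {} = 0\<close>.\<close>

definition upper_variation :: "('a::topological_space set \<Rightarrow> real) \<Rightarrow> 'a measure" where
  "upper_variation m =
     measure_of UNIV (sets borel) (\<lambda>A. SUP B \<in> {B \<in> sets borel. B \<subseteq> A}. ennreal (m B))"

definition signed_integral ::
    "('a::topological_space set \<Rightarrow> real) \<Rightarrow> ('a \<Rightarrow> real) \<Rightarrow> real" where
  "signed_integral m f =
     (\<integral>x. f x \<partial>upper_variation m) - (\<integral>x. f x \<partial>upper_variation (\<lambda>A. - m A))"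

definition has_distr_gradient ::
    "(real^'d::finite \<Rightarrow> real) \<Rightarrow> ((real^'d) set \<Rightarrow> real^'d) \<Rightarrow> bool" where
  "has_distr_gradient f \<mu> \<longleftrightarrow>
     (\<forall>\<phi> i. test_function \<phi> \<longrightarrow>
        (\<integral>x. f x * partial_deriv i \<phi> x \<partial>lebesgue) = - signed_integral (\<lambda>A. \<mu> A $ i) \<phi>)"

definition finite_perimeter :: "(real^'d::finite) set \<Rightarrow> bool" where
  "finite_perimeter U \<longleftrightarrow> U \<in> sets lebesgue \<and>
     (\<exists>\<mu>. finite_vector_measure \<mu> \<and> has_distr_gradient (indicat_real U) \<mu>)"

text \<open>For a set of finite perimeter the gradient measure is unique on Borel sets; its values on
  other sets are left arbitrary by the choice and are never used.\<close>

definition gradient_measure :: "(real^'d::finite) set \<Rightarrow> (real^'d) set \<Rightarrow> real^'d" where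
  "gradient_measure U =
     (SOME \<mu>. finite_vector_measure \<mu> \<and> has_distr_gradient (indicat_real U) \<mu>)"

definition perimeter_measure :: "(real^'d::finite) set \<Rightarrow> (real^'d) set \<Rightarrow> ennreal" where
  "perimeter_measure U = total_variation (gradient_measure U)"

definition half_open_cube :: "real^'d::finite \<Rightarrow> real \<Rightarrow> (real^'d) set" where
  "half_open_cube a l = {x. \<forall>i. a $ i \<le> x $ i \<and> x $ i < a $ i + l}"

definition side_length :: "(real^'d::finite) set \<Rightarrow> real" where
  "side_length Q = (THE l. l > 0 \<and> (\<exists>a. Q = half_open_cube a l))"

definition dyadic_system :: "(real^'d::finite) set set \<Rightarrow> bool" where
  "dyadic_system \<D> \<longleftrightarrow>
     (\<exists>D :: int \<Rightarrow> (real^'d) set set. \<D> = (\<Union>k. D k) \<and>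
        (\<forall>k. partition_on UNIV (D k) \<and>
             (\<forall>Q \<in> D k. \<exists>a. Q = half_open_cube a (2 powi k)) \<and>
             (\<forall>Q \<in> D k. \<exists>S \<subseteq> D (k - 1). card S = 2 ^ CARD('d) \<and> Q = \<Union>S)))"

end

theory Submission imports Defs begin

text \<open>The cubes are the maximal dyadic cubes \<open>Q\<close> with
  \<open>\<theta> / 2\<^sup>d \<le> |U \<inter> Q| / |Q| \<le> \<theta>\<close> for a small dimensional constant \<open>\<theta>\<close>. They are disjoint and cover
  \<open>U\<close>, because \<open>U\<close> is open and bounded, and the lower bound for the perimeter in \<open>Q\<close> is a relative
  isoperimetric inequality. To prove the latter, divide \<open>Q\<close> into \<open>N\<^sup>d\<close> cells and give every cell a
  product bump function, a translate of one fixed function. The difference of two bumps in the same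
  row is a partial derivative of a test function supported in the row, so the integrals of
  \<open>\<chi>\<^sub>U\<close> against the bumps of two cells are compared through the gradient measure of rows, one
  coordinate at a time. As \<open>U\<close> is open, for large \<open>N\<close> at least half of \<open>|U \<inter> Q|\<close> is made up of cells
  inside \<open>U\<close>. These see the full integral of their bump, while the average over all cells is at
  most half of that since \<open>|U \<inter> Q| \<le> \<theta> |Q|\<close>. No passage to the limit in the bump is needed, as
  \<open>\<theta>\<close> may depend on it.\<close>

section \<open>Smooth bump functions\<close>

text \<open>Smoothness means that this holds for every \<open>n\<close>. Level 0 asks for nothing,
  not even continuity, which is only available from level 1 on.\<close>

primrec times_differentiable :: "nat \<Rightarrow> (real \<Rightarrow> real) \<Rightarrow> bool" where
  "times_differentiable 0 f \<longleftrightarrow> True"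
| "times_differentiable (Suc n) f \<longleftrightarrow>
     (\<exists>f'. (\<forall>t. (f has_real_derivative f' t) (at t)) \<and> times_differentiable n f')"

lemma times_differentiable_SucD: "times_differentiable (Suc n) f \<Longrightarrow> times_differentiable n f"
  by (induction n arbitrary: f) auto

lemma times_differentiable_const: "times_differentiable n (\<lambda>_. c)"
proof (induction n arbitrary: c)
  case (Suc n)
  then show ?case by (auto intro!: exI[of _ "\<lambda>_. 0"])
qed simp

lemma times_differentiable_add:
  "times_differentiable n f \<Longrightarrow> times_differentiable n g \<Longrightarrow> times_differentiable n (\<lambda>t. f t + g t)"
proof (induction n arbitrary: f g)
  case (Suc n)
  then obtain f' g' where "\<forall>t. (f has_real_derivative f' t) (at t)" "times_differentiable n f'"
    "\<forall>t. (g has_real_derivative g' t) (at t)" "times_differentiable n g'" by auto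
  with Suc.IH show ?case
    by (auto intro!: exI[of _ "\<lambda>t. f' t + g' t"] derivative_intros)
qed simp

lemma times_differentiable_mult:
  "times_differentiable n f \<Longrightarrow> times_differentiable n g \<Longrightarrow> times_differentiable n (\<lambda>t. f t * g t)"
proof (induction n arbitrary: f g)
  case (Suc n)
  then obtain f' g' where d: "\<forall>t. (f has_real_derivative f' t) (at t)" "times_differentiable n f'"
    "\<forall>t. (g has_real_derivative g' t) (at t)" "times_differentiable n g'" by auto
  have "times_differentiable n f" "times_differentiable n g"
    using Suc.prems times_differentiable_SucD by auto
  with d Suc.IH have "times_differentiable n (\<lambda>t. f' t * g t + g' t * f t)"
    by (intro times_differentiable_add) auto
  with d show ?case
    by (auto intro!: exI[of _ "\<lambda>t. f' t * g t + g' t * f t"] derivative_intros)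
qed simp

lemma times_differentiable_affine:
  "times_differentiable n f \<Longrightarrow> times_differentiable n (\<lambda>t. f (b * t + c))"
proof (induction n arbitrary: f)
  case (Suc n)
  then obtain f' where d: "\<forall>t. (f has_real_derivative f' t) (at t)" "times_differentiable n f'"
    by auto
  have "((\<lambda>t. f (b * t + c)) has_real_derivative f' (b * t + c) * b) (at t)" for t
    by (rule DERIV_chain2[of f "f' (b * t + c)" "\<lambda>t. b * t + c"])
       (use d in \<open>auto intro!: derivative_eq_intros\<close>)
  moreover have "times_differentiable n (\<lambda>t. f' (b * t + c) * b)"
    using Suc.IH[OF d(2)] by (intro times_differentiable_mult times_differentiable_const)
  ultimately show ?case by (auto intro!: exI[of _ "\<lambda>t. f' (b * t + c) * b"])
qed simp

text \<open>This family is closed under differentiation, so a single induction with \<open>p\<close>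
  arbitrary makes all members smooth. \<open>flat 1\<close> is the classical exp(-1/t), extended by
  zero.\<close>

definition flat :: "real poly \<Rightarrow> real \<Rightarrow> real" where
  "flat p t = (if t \<le> 0 then 0 else poly p (1 / t) * exp (- (1 / t)))"

lemma poly_exp_minus_tendsto_0: "((\<lambda>y::real. poly p y * exp (- y)) \<longlongrightarrow> 0) at_top"
proof -
  have "((\<lambda>y. \<Sum>i\<le>degree p. coeff p i * (y ^ i / exp y)) \<longlongrightarrow> (\<Sum>i\<le>degree p. coeff p i * 0)) at_top"
    by (intro tendsto_intros tendsto_power_div_exp_0)
  moreover have "(\<Sum>i\<le>degree p. coeff p i * (y ^ i / exp y)) = poly p y * exp (- y)" for y
    by (simp add: poly_altdef exp_minus sum_distrib_right divide_inverse mult.assoc)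
  ultimately show ?thesis by simp
qed

text \<open>With s = 1/t one has ds/dt = -s^2, which produces the factor X^2, written
  \<open>[:0, 0, 1:]\<close>, and the polynomial p - p'. At 0 the right difference quotient is s
  p(s) exp(-s), which tends to 0 as s grows.\<close>

lemma flat_has_derivative:
  "(flat p has_real_derivative flat ([:0, 0, 1:] * (p - pderiv p)) t) (at t)"
proof -
  consider "t < 0" | "t > 0" | "t = 0" by linarith
  then show ?thesis
  proof cases
    case 1
    have "((\<lambda>_. 0) has_real_derivative 0) (at t)" by simp
    then have "(flat p has_real_derivative 0) (at t)"
      by (rule has_field_derivative_transform_within_open[of _ _ _ "{..<0}"])
         (use 1 in \<open>auto simp: flat_def\<close>)
    with 1 show ?thesis by (simp add: flat_def)
  next
    case 2
    have "((\<lambda>t. poly p (1 / t) * exp (- (1 / t))) has_real_derivative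
        poly (pderiv p) (1 / t) * (- 1 / t^2) * exp (- (1 / t)) +
        exp (- (1 / t)) * (1 / t^2) * poly p (1 / t)) (at t)"
      using 2 by (auto intro!: derivative_eq_intros DERIV_chain2[OF poly_DERIV] simp: power2_eq_square)
    then have "((\<lambda>t. poly p (1 / t) * exp (- (1 / t))) has_real_derivative
        flat ([:0, 0, 1:] * (p - pderiv p)) t) (at t)"
      using 2 by (simp add: flat_def field_simps power2_eq_square)
    then show ?thesis
      by (rule has_field_derivative_transform_within_open[of _ _ _ "{0<..}"])
         (use 2 in \<open>auto simp: flat_def\<close>)
  next
    case 3
    have "((\<lambda>h. flat p h / h) \<longlongrightarrow> 0) (at_left 0)"
      by (rule tendsto_eventually) (auto simp: flat_def eventually_at_filter)
    moreover have "((\<lambda>h. flat p h / h) \<longlongrightarrow> 0) (at_right 0)"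
    proof -
      have "((\<lambda>h. poly (pCons 0 p) (inverse h) * exp (- inverse h)) \<longlongrightarrow> 0) (at_right 0)"
        using poly_exp_minus_tendsto_0 filterlim_inverse_at_top_right by (rule filterlim_compose)
      then show ?thesis
        by (rule Lim_transform_eventually)
           (auto simp: flat_def eventually_at_filter field_simps)
    qed
    ultimately have "((\<lambda>h. flat p h / h) \<longlongrightarrow> 0) (at 0)"
      by (rule filterlim_split_at)
    then show ?thesis using 3 by (simp add: DERIV_def flat_def)
  qed
qed

lemma times_differentiable_flat: "times_differentiable n (flat p)"
proof (induction n arbitrary: p)
  case (Suc n)
  then show ?case using flat_has_derivative[of p] by auto
qed simp

text \<open>The antiderivative \<open>H\<close> makes the difference of two translates of \<open>g\<close> a derivative.\<close>

lemma smooth_bump_exists: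
  obtains g H :: "real \<Rightarrow> real" and \<kappa> :: real where
    "\<And>n. times_differentiable n g" "\<And>n. times_differentiable n H"
    "\<And>t. (H has_real_derivative g t) (at t)"
    "\<And>t. 0 \<le> g t" "\<And>t. g t \<le> 1" "\<And>t. t \<le> 0 \<or> 1 \<le> t \<Longrightarrow> g t = 0"
    "\<And>t. t \<le> 0 \<Longrightarrow> H t = 0" "\<And>t. 1 \<le> t \<Longrightarrow> H t = H 1" "\<And>t. 0 \<le> H t" "\<And>t. H t \<le> 1"
    "0 < \<kappa>" "\<And>t. 1/4 \<le> t \<Longrightarrow> t \<le> 3/4 \<Longrightarrow> \<kappa> \<le> g t"
proof -
  \<comment> \<open>The second factor is \<open>flat 1\<close> at 1 - t, written in the form b t + c
    of \<open>times_differentiable_affine\<close>. The product is supported in the unit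
    interval.\<close>
  define g where "g t = flat 1 t * flat 1 (-1 * t + 1)" for t
  have smooth: "times_differentiable n g" for n
    unfolding g_def by (intro times_differentiable_mult times_differentiable_flat times_differentiable_affine)
  have g0: "0 \<le> g t" and g1: "g t \<le> 1" for t
    by (auto simp: g_def flat_def intro!: mult_le_one)
  have supp: "g t = 0" if "t \<le> 0 \<or> 1 \<le> t" for t
    using that by (auto simp: g_def flat_def)
  \<comment> \<open>On the middle half of the unit interval both reciprocals are at most 4, so the
    exponents add up to at least -8.\<close>
  have low: "exp (- 8) \<le> g t" if "1/4 \<le> t" "t \<le> 3/4" for t
  proof -
    have "1 / t \<le> 4" "1 / (1 - t) \<le> 4" using that by (auto simp: field_simps)
    then show ?thesis using that by (auto simp: g_def flat_def simp flip: exp_add)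
  qed
  have cont: "continuous_on UNIV g"
  proof -
    from smooth[of 1] obtain g' where "\<And>t. (g has_real_derivative g' t) (at t)"
      by auto
    then show ?thesis
      by (intro DERIV_continuous_on) (rule has_field_derivative_at_within)
  qed
  obtain H0 where H0: "\<And>t. (H0 has_real_derivative g t) (at t)"
  proof -
    have "\<exists>F. \<forall>x. -\<infinity> < ereal x \<longrightarrow> ereal x < \<infinity> \<longrightarrow> (F has_vector_derivative g x) (at x)"
      using cont by (intro einterval_antiderivative) (auto simp: continuous_on_eq_continuous_at)
    then show ?thesis using that by (auto simp: has_real_derivative_iff_has_vector_derivative)
  qed
  define H where "H t = H0 t - H0 0" for t
  have H: "(H has_real_derivative g t) (at t)" for t
    unfolding H_def using H0 by (auto intro!: derivative_eq_intros)
  have mono: "H s \<le> H t" if "s \<le> t" for s t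
    using that H g0 by (intro DERIV_nonneg_imp_nondecreasing[of s t H]) auto
  have left: "H t = 0" if "t \<le> 0" for t
  proof (cases "t = 0")
    case False
    have "\<exists>z>t. z < 0 \<and> H 0 - H t = (0 - t) * g z"
      using that False H by (intro MVT2) auto
    then show ?thesis using supp by (auto simp: H_def)
  qed (simp add: H_def)
  have right: "H t = H 1" if "1 \<le> t" for t
  proof (cases "t = 1")
    case False
    have "\<exists>z>1. z < t \<and> H t - H 1 = (t - 1) * g z"
      using that False H by (intro MVT2) auto
    then show ?thesis using supp by auto
  qed simp
  \<comment> \<open>The mean value theorem on the unit interval turns \<open>H 1\<close> into a
    value of \<open>g\<close>, hence at most 1.\<close>
  have "\<exists>z>0. z < 1 \<and> H 1 - H 0 = (1 - 0) * g z"
    using H by (intro MVT2) auto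
  then have H1: "H 1 \<le> 1" using g1 by (auto simp: H_def)
  have H_nonneg: "0 \<le> H t" for t
    using left[of t] mono[of 0 t] left[of 0] by (cases "t \<le> 0") auto
  have H_le: "H t \<le> 1" for t
    using right[of t] mono[of t 1] H1 by (cases "t \<le> 1") auto
  have Hs: "times_differentiable n H" for n
    by (cases n) (use H smooth in auto)
  show ?thesis
    using that[of g H "exp (- 8)", OF smooth Hs H g0 g1 supp left right H_nonneg H_le _ low] by simp
qed

section \<open>Test functions of product form\<close>

lemma has_derivative_prod_components:
  fixes x :: "real^'d::finite"
  assumes "\<And>j t. (h j has_real_derivative h' j t) (at t)"
  shows "((\<lambda>x. \<Prod>j\<in>UNIV. h j (x $ j)) has_derivative
     (\<lambda>y. \<Sum>i\<in>UNIV. (h' i (x $ i) * y $ i) * (\<Prod>j\<in>UNIV - {i}. h j (x $ j)))) (at x)"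
proof (rule has_derivative_prod)
  fix j :: 'd
  have "((\<lambda>x::real^'d. x $ j) has_derivative (\<lambda>y. y $ j)) (at x)"
    by (rule bounded_linear_imp_has_derivative) (rule bounded_linear_vec_nth)
  moreover have "(h j has_derivative (\<lambda>t. h' j (x $ j) * t)) (at (x $ j))"
    using assms[of j "x $ j"] by (simp add: has_field_derivative_def)
  ultimately show "((\<lambda>x. h j (x $ j)) has_derivative (\<lambda>y. h' j (x $ j) * y $ j)) (at x)"
    using diff_chain_at[of "\<lambda>x. x $ j" "\<lambda>y. y $ j" x "h j"] by (simp add: o_def)
qed

text \<open>The result is again a product of functions of single coordinates, with one factor
  replaced. This stability is what drives the induction on the order of differentiability.\<close>

lemma partial_deriv_prod_components:
  fixes h :: "'d::finite \<Rightarrow> real \<Rightarrow> real"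
  assumes "\<And>j t. (h j has_real_derivative h' j t) (at t)"
  shows "partial_deriv i (\<lambda>x. \<Prod>j\<in>UNIV. h j (x $ j)) =
    (\<lambda>x. \<Prod>j\<in>UNIV. (h(i := h' i)) j (x $ j))"
proof
  fix x :: "real^'d"
  have "partial_deriv i (\<lambda>x. \<Prod>j\<in>UNIV. h j (x $ j)) x =
      (\<Sum>k\<in>UNIV. (h' k (x $ k) * axis i 1 $ k) * (\<Prod>j\<in>UNIV - {k}. h j (x $ j)))"
    unfolding partial_deriv_def
    by (simp add: frechet_derivative_at[OF has_derivative_prod_components[of h h', OF assms], symmetric])
  also have "\<dots> = h' i (x $ i) * (\<Prod>j\<in>UNIV - {i}. h j (x $ j))"
    by (subst sum.remove[of UNIV i]) (auto simp: axis_def intro!: sum.neutral)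
  also have "\<dots> = (\<Prod>j\<in>UNIV. (h(i := h' i)) j (x $ j))"
    by (subst prod.remove[of UNIV i]) (auto intro!: prod.cong)
  finally show "partial_deriv i (\<lambda>x. \<Prod>j\<in>UNIV. h j (x $ j)) x = \<dots>" .
qed

text \<open>The extra order in \<open>Suc k\<close> pays for the base case, where continuity has to
  come from a derivative.\<close>

lemma cont_diff_prod_components:
  fixes h :: "'d::finite \<Rightarrow> real \<Rightarrow> real"
  assumes "\<And>j. times_differentiable (Suc k) (h j)"
  shows "cont_diff k (\<lambda>x. \<Prod>j\<in>UNIV. h j (x $ j))"
  using assms
proof (induction k arbitrary: h)
  case 0
  then have "\<forall>j. \<exists>h'. \<forall>t. (h j has_real_derivative h' t) (at t)"
    by simp
  then obtain h' where "\<And>j t. (h j has_real_derivative h' j t) (at t)"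
    by metis
  from has_derivative_continuous[OF has_derivative_prod_components[of h h', OF this]]
  show ?case
    by (simp add: continuous_at_imp_continuous_on)
next
  case (Suc k)
  have "\<forall>j. \<exists>h'. (\<forall>t. (h j has_real_derivative h' t) (at t)) \<and> times_differentiable (Suc k) h'"
    using Suc.prems by (metis times_differentiable.simps(2))
  then obtain h' where h': "\<And>j t. (h j has_real_derivative h' j t) (at t)"
    "\<And>j. times_differentiable (Suc k) (h' j)"
    by metis
  have "(\<lambda>x. \<Prod>j\<in>UNIV. h j (x $ j)) differentiable_on UNIV"
    using has_derivative_prod_components[of h h', OF h'(1)]
    by (auto simp: differentiable_on_def differentiable_def)
  moreover have "cont_diff k (partial_deriv i (\<lambda>x. \<Prod>j\<in>UNIV. h j (x $ j)))" for i
    unfolding partial_deriv_prod_components[of h h', OF h'(1)]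
    using Suc.IH[of "h(i := h' i)"] times_differentiable_SucD[OF Suc.prems] h'(2) by simp
  ultimately show ?case by simp
qed

lemma test_function_prod_components:
  fixes h :: "'d::finite \<Rightarrow> real \<Rightarrow> real"
  assumes "\<And>j n. times_differentiable n (h j)"
    and "\<And>j t. h j t \<noteq> 0 \<Longrightarrow> lo j \<le> t \<and> t \<le> hi j"
  shows "test_function (\<lambda>x. \<Prod>j\<in>UNIV. h j (x $ j))"
proof -
  have "{x. (\<Prod>j\<in>UNIV. h j (x $ j)) \<noteq> 0} \<subseteq> cbox (\<chi> j. lo j) (\<chi> j. hi j)"
    using assms(2) by (auto simp: mem_box_cart)
  then have "bounded {x. (\<Prod>j\<in>UNIV. h j (x $ j)) \<noteq> 0}"
    using bounded_cbox bounded_subset by blast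
  then show ?thesis
    using assms(1) by (auto simp: test_function_def compact_closure intro!: cont_diff_prod_components
        simp del: times_differentiable.simps)
qed

section \<open>Variation of vector measures\<close>

text \<open>\<open>measure_of\<close> returns the given set function if that is a measure and zero
  otherwise. The inequality holds in both cases, and the estimates below only ask for upper
  bounds.\<close>

lemma emeasure_upper_variation_le:
  "emeasure (upper_variation m) A \<le> (SUP B \<in> {B \<in> sets borel. B \<subseteq> A}. ennreal (m B))"
  unfolding upper_variation_def emeasure_measure_of_conv by simp

lemma sets_upper_variation [simp, measurable_cong]:
  "sets (upper_variation (m :: 'a::topological_space set \<Rightarrow> real)) = sets borel"
proof -
  have "sets (upper_variation m) = sigma_sets UNIV (sets borel)"
    unfolding upper_variation_def by (rule sets_measure_of) simp
  also have "\<dots> = sets borel"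
    using sets.sigma_sets_eq[of "borel :: 'a measure"] by (simp del: sets.sigma_sets_eq)
  finally show ?thesis .
qed

lemma space_upper_variation [simp]: "space (upper_variation m) = UNIV"
  unfolding upper_variation_def by (rule space_measure_of) simp

text \<open>The sets \<open>B\<close> and \<open>A - B\<close>, padded with empty sets, are one of
  the partitions in the supremum.\<close>

lemma norm_le_total_variation:
  assumes "B \<in> sets borel" "A \<in> sets borel" "B \<subseteq> A"
  shows "ennreal (norm (\<mu> B)) \<le> total_variation \<mu> A"
proof -
  define E where "E n = (if n = 0 then B else if n = 1 then A - B else {})" for n :: nat
  have "(\<Sum>n\<in>{0}. ennreal (norm (\<mu> (E n)))) \<le> (\<Sum>n. ennreal (norm (\<mu> (E n))))"
    by (intro sum_le_suminf summableI finite.intros zero_le)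
  also have "\<dots> \<le> total_variation \<mu> A"
    unfolding total_variation_def
    by (rule SUP_upper) (use assms in \<open>auto simp: E_def disjoint_family_on_def split: if_splits\<close>)
  finally show ?thesis by (simp add: E_def)
qed

text \<open>A component is at most the norm in absolute value, so every Borel subset in the supremum
  obeys the previous bound.\<close>

lemma upper_variation_component_le:
  fixes \<mu> :: "(real^'d::finite) set \<Rightarrow> real^'d"
  assumes "A \<in> sets borel"
  shows "emeasure (upper_variation (\<lambda>A. \<mu> A $ i)) A \<le> total_variation \<mu> A"
    and "emeasure (upper_variation (\<lambda>A. - \<mu> A $ i)) A \<le> total_variation \<mu> A"
proof -
  have "ennreal (\<mu> B $ i) \<le> total_variation \<mu> A" "ennreal (- \<mu> B $ i) \<le> total_variation \<mu> A"
    if "B \<in> {B \<in> sets borel. B \<subseteq> A}" for B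
  proof -
    have "\<mu> B $ i \<le> norm (\<mu> B)" "- \<mu> B $ i \<le> norm (\<mu> B)"
      using component_le_norm_cart[of "\<mu> B" i] by auto
    then show "ennreal (\<mu> B $ i) \<le> total_variation \<mu> A" "ennreal (- \<mu> B $ i) \<le> total_variation \<mu> A"
      using norm_le_total_variation[of B A \<mu>] that assms by (auto intro: order_trans ennreal_leI)
  qed
  then show "emeasure (upper_variation (\<lambda>A. \<mu> A $ i)) A \<le> total_variation \<mu> A"
    "emeasure (upper_variation (\<lambda>A. - \<mu> A $ i)) A \<le> total_variation \<mu> A"
    by (auto intro!: order_trans[OF emeasure_upper_variation_le] SUP_least)
qed

lemma abs_integral_le_measure_support:
  fixes f :: "'a \<Rightarrow> real"
  assumes "f \<in> borel_measurable M" "T \<in> sets M" "emeasure M T < \<infinity>"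
    and "\<And>x. \<bar>f x\<bar> \<le> c * indicator T x"
  shows "\<bar>\<integral>x. f x \<partial>M\<bar> \<le> c * measure M T"
proof -
  have int: "integrable M (\<lambda>x. c * indicator T x)"
    using assms by (intro integrable_mult_right integrable_real_indicator) auto
  then have "integrable M f"
    by (rule Bochner_Integration.integrable_bound) (use assms in \<open>auto intro: order_trans[OF _ abs_ge_self]\<close>)
  then have "\<bar>\<integral>x. f x \<partial>M\<bar> \<le> (\<integral>x. c * indicator T x \<partial>M)"
    by (intro order_trans[OF integral_abs_bound] integral_mono integrable_abs int assms(4))
  also have "\<dots> = c * measure M T"
    using assms(2) sets.sets_into_space[of T M] by (simp add: Int_absorb2)
  finally show ?thesis .
qed

text \<open>This plays the role of the total variation of the i-th component. Being built from two
  genuine measures, it can be added up over disjoint cells, unlike the bare supremum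
  \<open>total_variation\<close>.\<close>

definition component_variation :: "((real^'d::finite) set \<Rightarrow> real^'d) \<Rightarrow> 'd \<Rightarrow> (real^'d) set \<Rightarrow> real" where
  "component_variation \<mu> i A =
     measure (upper_variation (\<lambda>A. \<mu> A $ i)) A + measure (upper_variation (\<lambda>A. - \<mu> A $ i)) A"

lemma abs_signed_integral_le:
  assumes "f \<in> borel_measurable borel" "T \<in> sets borel" "total_variation \<mu> UNIV < \<infinity>"
    and "\<And>x. \<bar>f x\<bar> \<le> c * indicator T x"
  shows "\<bar>signed_integral (\<lambda>A. \<mu> A $ i) f\<bar> \<le> c * component_variation \<mu> i T"
proof -
  have fin: "emeasure (upper_variation (\<lambda>A. \<mu> A $ i)) T < \<infinity>"
    "emeasure (upper_variation (\<lambda>A. - \<mu> A $ i)) T < \<infinity>"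
    using upper_variation_component_le[of UNIV \<mu> i] assms(3)
      emeasure_mono[of T UNIV "upper_variation (\<lambda>A. \<mu> A $ i)"]
      emeasure_mono[of T UNIV "upper_variation (\<lambda>A. - \<mu> A $ i)"]
    by (auto intro: le_less_trans)
  have "f \<in> borel_measurable (upper_variation m)" for m
    using assms(1) by (simp cong: measurable_cong_sets)
  from abs_integral_le_measure_support[OF this _ fin(1) assms(4)]
    abs_integral_le_measure_support[OF this _ fin(2) assms(4)]
  show ?thesis
    using assms(2) by (simp add: signed_integral_def component_variation_def distrib_left)
qed

section \<open>Cubes and grids\<close>

lemma sets_half_open_cube [measurable, simp]: "half_open_cube a l \<in> sets borel"
  unfolding half_open_cube_def by measurable

lemma half_open_cube_bounds:
  "box a (\<chi> j. a $ j + l) \<subseteq> half_open_cube a l" "half_open_cube a l \<subseteq> cbox a (\<chi> j. a $ j + l)"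
  by (auto simp: half_open_cube_def mem_box_cart less_imp_le)

lemma bounded_half_open_cube: "bounded (half_open_cube a l)"
  using bounded_subset[OF bounded_cbox half_open_cube_bounds(2)] .

lemma fmeasurable_half_open_cube [simp]: "half_open_cube a l \<in> lmeasurable"
  by (intro fmeasurableI2[OF lmeasurable_cbox half_open_cube_bounds(2)]) simp

text \<open>The cube lies between an open and a closed box of the same volume.\<close>

lemma measure_half_open_cube:
  fixes a :: "real^'d::finite"
  assumes "0 < l"
  shows "measure lebesgue (half_open_cube a l) = l ^ CARD('d)"
proof (rule antisym)
  have c: "measure lebesgue (cbox a (\<chi> j. a $ j + l)) = l ^ CARD('d)"
    using assms content_cbox_cart[of a "\<chi> j. a $ j + l"] by (auto simp: interval_eq_empty_cart)
  have b: "measure lebesgue (box a (\<chi> j. a $ j + l)) = l ^ CARD('d)"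
    using c by (simp add: measure_lborel_box_eq measure_lborel_cbox_eq)
  show "measure lebesgue (half_open_cube a l) \<le> l ^ CARD('d)"
    unfolding c[symmetric] by (intro measure_mono_fmeasurable half_open_cube_bounds) auto
  show "l ^ CARD('d) \<le> measure lebesgue (half_open_cube a l)"
    unfolding b[symmetric] by (intro measure_mono_fmeasurable half_open_cube_bounds) auto
qed

text \<open>Equal cubes have equal volume, and the volume determines the side; hence the description
  in \<open>side_length\<close> is unique.\<close>

lemma side_length_half_open_cube:
  fixes a :: "real^'d::finite"
  assumes "0 < l"
  shows "side_length (half_open_cube a l) = l"
  unfolding side_length_def
proof (rule the_equality)
  fix m assume "0 < m \<and> (\<exists>b. half_open_cube a l = half_open_cube b m)"
  then have "m ^ CARD('d) = l ^ CARD('d)" "0 < m"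
    using measure_half_open_cube assms by metis+
  then show "m = l"
    using assms by (metis power_eq_imp_eq_base less_imp_le zero_less_card_finite)
qed (use assms in auto)

text \<open>The factor \<open>CARD('d)\<close> comes from estimating the Euclidean norm by the sum
  of the coordinates, each at most \<open>l\<close>.\<close>

lemma half_open_cube_subset_ball:
  fixes x :: "real^'d::finite" and l e :: real
  assumes "x \<in> half_open_cube a l" "CARD('d) * l < e"
  shows "half_open_cube a l \<subseteq> ball x e"
proof
  fix y assume y: "y \<in> half_open_cube a l"
  have "\<bar>(x - y) $ j\<bar> \<le> l" for j
  proof -
    have "a $ j \<le> x $ j" "x $ j < a $ j + l" "a $ j \<le> y $ j" "y $ j < a $ j + l"
      using assms(1) y by (simp_all add: half_open_cube_def)
    then show ?thesis by (simp add: abs_le_iff)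
  qed
  then have "norm (x - y) \<le> (\<Sum>j\<in>(UNIV :: 'd set). l)"
    by (intro order_trans[OF norm_le_l1_cart] sum_mono)
  then show "y \<in> ball x e" using assms(2) by (simp add: dist_norm)
qed

lemma sum_measure_le:
  assumes "finite I" "disjoint_family_on A I" "\<And>i. i \<in> I \<Longrightarrow> A i \<in> sets M" "(\<Union>i\<in>I. A i) \<subseteq> B"
    and "B \<in> fmeasurable M"
  shows "(\<Sum>i\<in>I. measure M (A i)) \<le> measure M B"
proof -
  have "A i \<in> fmeasurable M" if "i \<in> I" for i
    using that assms by (intro fmeasurableI2[OF assms(5)]) auto
  then have "(\<Sum>i\<in>I. measure M (A i)) = measure M (\<Union>i\<in>I. A i)"
    using assms by (intro measure_UNION'[symmetric]) (auto simp: disjoint_family_on_def pairwise_def disjnt_def)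
  also have "\<dots> \<le> measure M B"
    using assms by (intro measure_mono_fmeasurable) auto
  finally show ?thesis .
qed

text \<open>Describing a cell by integer parts makes disjointness immediate and lets the cell of a
  point be read off with a floor. The next lemma recovers the description as a half-open
  cube.\<close>

definition grid_cell :: "real^'d::finite \<Rightarrow> real \<Rightarrow> ('d \<Rightarrow> nat) \<Rightarrow> (real^'d) set" where
  "grid_cell a \<delta> c = {x. \<forall>j. \<lfloor>(x $ j - a $ j) / \<delta>\<rfloor> = int (c j)}"

lemma grid_cell_eq_half_open_cube:
  assumes "0 < \<delta>"
  shows "grid_cell a \<delta> c = half_open_cube (\<chi> j. a $ j + \<delta> * c j) \<delta>"
  using assms by (auto simp: grid_cell_def half_open_cube_def floor_eq_iff field_simps)

lemma sets_grid_cell [simp]: "0 < \<delta> \<Longrightarrow> grid_cell a \<delta> c \<in> sets borel"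
  by (simp add: grid_cell_eq_half_open_cube)

lemma disjoint_family_grid_cell: "disjoint_family_on (grid_cell a \<delta>) I"
  by (auto simp: disjoint_family_on_def grid_cell_def fun_eq_iff)

definition grid_index :: "nat \<Rightarrow> ('d::finite \<Rightarrow> nat) set" where
  "grid_index N = {c. \<forall>j. c j < N}"

lemma grid_index_eq_Pi: "grid_index N = PiE UNIV (\<lambda>_. {..<N})"
  by (auto simp: grid_index_def PiE_def)

lemma finite_grid_index [simp]: "finite (grid_index N :: ('d::finite \<Rightarrow> nat) set)"
  by (simp add: grid_index_eq_Pi finite_PiE)

lemma card_grid_index: "card (grid_index N :: ('d::finite \<Rightarrow> nat) set) = N ^ CARD('d)"
  by (simp add: grid_index_eq_Pi card_PiE)

lemma Union_grid_cell:
  assumes "0 < l" "0 < N"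
  shows "(\<Union>c\<in>grid_index N. grid_cell a (l / N) c) = half_open_cube a l"
proof -
  have "0 \<le> (x $ j - a $ j) / (l / N) \<longleftrightarrow> a $ j \<le> x $ j"
    "(x $ j - a $ j) / (l / N) < N \<longleftrightarrow> x $ j < a $ j + l" for x and j :: 'a
    using assms by (auto simp: zero_le_divide_iff zero_le_mult_iff pos_divide_less_eq)
  then have "x \<in> half_open_cube a l \<longleftrightarrow>
      (\<forall>j. 0 \<le> (x $ j - a $ j) / (l / N) \<and> (x $ j - a $ j) / (l / N) < N)" for x
    by (simp add: half_open_cube_def)
  also have "\<dots> x \<longleftrightarrow> (\<forall>j. \<exists>n<N. \<lfloor>(x $ j - a $ j) / (l / N)\<rfloor> = int n)" for x
  proof (intro all_cong1 iffI)
    fix j assume *: "0 \<le> (x $ j - a $ j) / (l / N) \<and> (x $ j - a $ j) / (l / N) < N"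
    show "\<exists>n<N. \<lfloor>(x $ j - a $ j) / (l / N)\<rfloor> = int n"
      by (rule exI[of _ "nat \<lfloor>(x $ j - a $ j) / (l / N)\<rfloor>"]) (use * in \<open>auto simp: nat_less_iff floor_less_iff\<close>)
  next
    fix j assume "\<exists>n<N. \<lfloor>(x $ j - a $ j) / (l / N)\<rfloor> = int n"
    then show "0 \<le> (x $ j - a $ j) / (l / N) \<and> (x $ j - a $ j) / (l / N) < N"
      by (metis of_int_of_nat_eq floor_less_iff of_nat_less_iff zero_le_floor of_nat_0_le_iff)
  qed
  also have "\<dots> x \<longleftrightarrow> x \<in> (\<Union>c\<in>grid_index N. grid_cell a (l / N) c)" for x
    by (auto simp: grid_index_def grid_cell_def choice_iff)
  finally show ?thesis by blast
qed

text \<open>Two indices are joined by changing one coordinate at a time; exchanging the coordinates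
  in \<open>S\<close> between them is an involution on pairs of indices.\<close>

lemma sum_abs_diff_grid_le:
  fixes \<beta> :: "('d::finite \<Rightarrow> nat) \<Rightarrow> real"
  assumes step: "\<And>c i t. c \<in> grid_index N \<Longrightarrow> t < N \<Longrightarrow>
      \<bar>\<beta> c - \<beta> (c(i := t))\<bar> \<le> (\<Sum>s<N. m i (c(i := s)))"
  shows "(\<Sum>c\<in>grid_index N. \<Sum>c'\<in>grid_index N. \<bar>\<beta> c - \<beta> c'\<bar>) \<le>
     real N ^ CARD('d) * (N * (\<Sum>i\<in>UNIV. \<Sum>c\<in>grid_index N. m i c))"
proof -
  let ?K = "grid_index N :: ('d \<Rightarrow> nat) set"
  define mix where "mix S c c' = (\<lambda>j. if j \<in> S then c' j else c j)" for S and c c' :: "'d \<Rightarrow> nat"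
  \<comment> \<open>The involution exchanging \<open>s\<close> with the i-th coordinate of
    \<open>c\<close> turns the summand into one free of \<open>s\<close>; the free \<open>s\<close>
    then contributes the factor \<open>N\<close>.\<close>
  have tube: "(\<Sum>c\<in>?K. \<Sum>s<N. m i (c(i := s))) = N * (\<Sum>c\<in>?K. m i c)" for i
  proof -
    have "(\<Sum>c\<in>?K. \<Sum>s<N. m i (c(i := s))) = (\<Sum>(c, s)\<in>?K \<times> {..<N}. m i (c(i := s)))"
      by (simp add: sum.cartesian_product)
    also have "\<dots> = (\<Sum>(c, s)\<in>?K \<times> {..<N}. m i c)"
      by (rule sum.reindex_bij_witness[where i = "\<lambda>(c, s). (c(i := s), c i)" and j = "\<lambda>(c, s). (c(i := s), c i)"])
         (auto simp: grid_index_def)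
    also have "\<dots> = N * (\<Sum>c\<in>?K. m i c)"
      by (simp add: sum.cartesian_product[symmetric] sum_distrib_left)
    finally show ?thesis .
  qed
  \<comment> \<open>Induction on the set \<open>S\<close> of coordinates already taken over from
    \<open>c'\<close>. For \<open>S\<close> the whole index type, \<open>mix\<close> returns
    \<open>c'\<close>.\<close>
  have "(\<Sum>(c, c')\<in>?K \<times> ?K. \<bar>\<beta> c - \<beta> (mix S c c')\<bar>) \<le>
      (\<Sum>i\<in>S. real N ^ CARD('d) * (N * (\<Sum>c\<in>?K. m i c)))" if "finite S" for S
    using that
  proof (induction S)
    case empty
    then show ?case by (simp add: mix_def case_prod_beta)
  next
    case (insert i S)
    have mixK: "mix S c c' \<in> ?K" if "c \<in> ?K" "c' \<in> ?K" for c c'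
      using that by (auto simp: mix_def grid_index_def)
    have upd: "mix (insert i S) c c' = (mix S c c')(i := c' i)" for c c'
      by (auto simp: mix_def)
    have "(\<Sum>(c, c')\<in>?K \<times> ?K. \<bar>\<beta> c - \<beta> (mix (insert i S) c c')\<bar>) \<le>
        (\<Sum>(c, c')\<in>?K \<times> ?K. \<bar>\<beta> c - \<beta> (mix S c c')\<bar> + (\<Sum>s<N. m i ((mix S c c')(i := s))))"
    proof (rule sum_mono, clarsimp)
      fix c c' assume "c \<in> ?K" "c' \<in> ?K"
      then have "\<bar>\<beta> (mix S c c') - \<beta> (mix (insert i S) c c')\<bar> \<le> (\<Sum>s<N. m i ((mix S c c')(i := s)))"
        unfolding upd by (intro step mixK) (auto simp: grid_index_def)
      then show "\<bar>\<beta> c - \<beta> (mix (insert i S) c c')\<bar> \<le>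
          \<bar>\<beta> c - \<beta> (mix S c c')\<bar> + (\<Sum>s<N. m i ((mix S c c')(i := s)))"
        by linarith
    qed
    also have "\<dots> = (\<Sum>(c, c')\<in>?K \<times> ?K. \<bar>\<beta> c - \<beta> (mix S c c')\<bar>) +
        (\<Sum>(c, c')\<in>?K \<times> ?K. \<Sum>s<N. m i ((mix S c c')(i := s)))"
      by (simp add: case_prod_beta sum.distrib)
    also have "(\<Sum>(c, c')\<in>?K \<times> ?K. \<Sum>s<N. m i ((mix S c c')(i := s))) =
        (\<Sum>(c, c')\<in>?K \<times> ?K. \<Sum>s<N. m i (c(i := s)))"
      by (rule sum.reindex_bij_witness[where i = "\<lambda>(c, c'). (mix S c c', mix S c' c)"
            and j = "\<lambda>(c, c'). (mix S c c', mix S c' c)"])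
         (auto simp: mix_def grid_index_def)
    \<comment> \<open>Only the first index occurs any more, so the second sum just counts all
      indices.\<close>
    also have "\<dots> = real N ^ CARD('d) * (N * (\<Sum>c\<in>?K. m i c))"
      by (simp add: sum.cartesian_product[symmetric] sum_distrib_left[symmetric] tube card_grid_index)
    finally show ?case using insert by simp
  qed
  from this[of UNIV] show ?thesis
    by (simp add: mix_def sum.cartesian_product[symmetric] sum_distrib_left)
qed

lemma component_variation_sum_le:
  assumes "total_variation \<mu> UNIV < \<infinity>" "finite I" "disjoint_family_on A I"
    and "\<And>i. i \<in> I \<Longrightarrow> A i \<in> sets borel" "(\<Union>i\<in>I. A i) \<subseteq> B" "B \<in> sets borel"
  shows "(\<Sum>i\<in>I. component_variation \<mu> k (A i)) \<le> component_variation \<mu> k B"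
proof -
  have "emeasure (upper_variation (\<lambda>A. \<mu> A $ k)) B < \<infinity>"
    "emeasure (upper_variation (\<lambda>A. - \<mu> A $ k)) B < \<infinity>"
    using upper_variation_component_le[of UNIV \<mu> k] assms(1)
      emeasure_mono[of B UNIV "upper_variation (\<lambda>A. \<mu> A $ k)"]
      emeasure_mono[of B UNIV "upper_variation (\<lambda>A. - \<mu> A $ k)"]
    by (auto intro: le_less_trans)
  then have "B \<in> fmeasurable (upper_variation (\<lambda>A. \<mu> A $ k))"
    "B \<in> fmeasurable (upper_variation (\<lambda>A. - \<mu> A $ k))"
    using assms(6) by (auto simp: fmeasurable_def)
  then show ?thesis
    unfolding component_variation_def sum.distrib
    using assms by (intro add_mono sum_measure_le) auto
qed

text \<open>The factor 2 stands for the two Jordan parts, each bounded by the full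
  variation.\<close>

lemma component_variation_le:
  assumes "B \<in> sets borel" "total_variation \<mu> B = ennreal v" "0 \<le> v"
  shows "component_variation \<mu> k B \<le> 2 * v"
proof -
  have "measure M B \<le> v" if "emeasure M B \<le> ennreal v" for M
    using that assms(3) by (simp add: measure_def enn2real_leI)
  from this[OF upper_variation_component_le(1)[OF assms(1), of \<mu> k, unfolded assms(2)]]
    this[OF upper_variation_component_le(2)[OF assms(1), of \<mu> k, unfolded assms(2)]]
  show ?thesis unfolding component_variation_def by simp
qed

section \<open>The relative isoperimetric inequality\<close>

lemma integrable_indicator_fmeasurable: "A \<in> fmeasurable M \<Longrightarrow> integrable M (indicat_real A)"
  by (rule integrable_real_indicator) (auto simp: fmeasurable_def)

text \<open>One profile, as supplied by \<open>smooth_bump_exists\<close>, is fixed for every set,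
  cube and grid, so all later constants depend only on it and on the dimension.\<close>

locale smooth_bump =
  fixes g H :: "real \<Rightarrow> real" and \<kappa> :: real
  assumes smooth_g: "\<And>n. times_differentiable n g"
    and smooth_H: "\<And>n. times_differentiable n H"
    and deriv_H: "\<And>t. (H has_real_derivative g t) (at t)"
    and g_nonneg: "\<And>t. 0 \<le> g t" and g_le_1: "\<And>t. g t \<le> 1"
    and g_support: "\<And>t. t \<le> 0 \<or> 1 \<le> t \<Longrightarrow> g t = 0"
    and H_left: "\<And>t. t \<le> 0 \<Longrightarrow> H t = 0" and H_right: "\<And>t. 1 \<le> t \<Longrightarrow> H t = H 1"
    and H_nonneg: "\<And>t. 0 \<le> H t" and H_le_1: "\<And>t. H t \<le> 1"
    and \<kappa>_pos: "0 < \<kappa>" and g_lower: "\<And>t. 1/4 \<le> t \<Longrightarrow> t \<le> 3/4 \<Longrightarrow> \<kappa> \<le> g t"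
begin

definition bump :: "real^'d::finite \<Rightarrow> real \<Rightarrow> ('d \<Rightarrow> nat) \<Rightarrow> real^'d \<Rightarrow> real" where
  "bump a \<delta> c x = (\<Prod>j\<in>UNIV. g ((x $ j - a $ j) / \<delta> - c j))"

text \<open>A smoothed volume of the part of \<open>U\<close> in one cell. The bump is not
  normalized: it has values between 0 and 1, so the weight is at most the true volume.\<close>

definition weight :: "(real^'d::finite) set \<Rightarrow> real^'d \<Rightarrow> real \<Rightarrow> ('d \<Rightarrow> nat) \<Rightarrow> real" where
  "weight U a \<delta> c = (\<integral>x. indicat_real U x * bump a \<delta> c x \<partial>lebesgue)"

lemma bump_nonneg: "0 \<le> bump a \<delta> c x"
  by (simp add: bump_def prod_nonneg g_nonneg)

text \<open>Outside the cell some rescaled coordinate leaves the unit interval, and the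
  corresponding factor vanishes.\<close>

lemma bump_le_indicator: "bump a \<delta> c x \<le> indicator (grid_cell a \<delta> c) x"
proof (cases "x \<in> grid_cell a \<delta> c")
  case True
  then show ?thesis by (simp add: bump_def prod_le_1 g_nonneg g_le_1)
next
  case False
  then obtain j where "\<lfloor>(x $ j - a $ j) / \<delta>\<rfloor> \<noteq> int (c j)"
    by (auto simp: grid_cell_def)
  then have "g ((x $ j - a $ j) / \<delta> - c j) = 0"
    by (intro g_support) (auto simp: floor_eq_iff)
  then have "bump a \<delta> c x = 0"
    unfolding bump_def by (intro prod_zero) auto
  then show ?thesis by simp
qed

lemma continuous_on_g: "continuous_on UNIV g"
proof -
  from smooth_g[of 1] obtain g' where "\<And>t. (g has_real_derivative g' t) (at t)"
    by auto
  then show ?thesis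
    by (intro DERIV_continuous_on) (rule has_field_derivative_at_within)
qed

lemma borel_measurable_bump [measurable]: "bump a \<delta> c \<in> borel_measurable borel"
proof -
  have [measurable]: "g \<in> borel_measurable borel"
    by (rule borel_measurable_continuous_onI) (rule continuous_on_g)
  show ?thesis unfolding bump_def[abs_def] by measurable
qed

lemma integrable_weight:
  assumes "0 < \<delta>" "U \<in> sets lebesgue"
  shows "integrable lebesgue (\<lambda>x. indicat_real U x * bump a \<delta> c x)"
proof -
  have int: "integrable lebesgue (indicat_real (grid_cell a \<delta> c))"
    using assms(1) by (simp add: grid_cell_eq_half_open_cube integrable_indicator_fmeasurable)
  have "bump a \<delta> c \<in> borel_measurable lebesgue"
    by (intro measurable_completion) simp
  then have meas: "(\<lambda>x. indicat_real U x * bump a \<delta> c x) \<in> borel_measurable lebesgue"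
    using assms(2) by (intro borel_measurable_times borel_measurable_indicator)
  have "norm (indicat_real U x * bump a \<delta> c x) \<le> norm (indicat_real (grid_cell a \<delta> c) x)" for x
    using bump_nonneg[of a \<delta> c x] bump_le_indicator[of a \<delta> c x] by (auto simp: indicator_def)
  then show ?thesis
    by (intro Bochner_Integration.integrable_bound[OF int meas] AE_I2)
qed

lemma weight_le:
  assumes "0 < \<delta>" "U \<in> sets lebesgue"
  shows "weight U a \<delta> c \<le> measure lebesgue (U \<inter> grid_cell a \<delta> c)"
proof -
  have fm: "U \<inter> grid_cell a \<delta> c \<in> lmeasurable"
    using assms by (intro fmeasurable_Int_fmeasurable[of _ _ U, unfolded Int_commute[of _ U]])
      (auto simp: grid_cell_eq_half_open_cube)
  have "weight U a \<delta> c \<le> (\<integral>x. indicat_real (U \<inter> grid_cell a \<delta> c) x \<partial>lebesgue)"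
    unfolding weight_def
  proof (intro integral_mono integrable_weight integrable_indicator_fmeasurable assms fm)
    show "indicat_real U x * bump a \<delta> c x \<le> indicat_real (U \<inter> grid_cell a \<delta> c) x" for x
      using bump_le_indicator[of a \<delta> c x] by (auto simp: indicator_def)
  qed
  then show ?thesis by simp
qed

text \<open>On the concentric cube of half the side every factor of the bump is at least \<kappa>,
  and this cube lies in \<open>U\<close>.\<close>

lemma weight_ge:
  fixes a :: "real^'d::finite"
  assumes "0 < \<delta>" "U \<in> sets lebesgue" "grid_cell a \<delta> c \<subseteq> U"
  shows "(\<kappa> / 2 * \<delta>) ^ CARD('d) \<le> weight U a \<delta> c"
proof -
  define B where "B = half_open_cube (\<chi> j. a $ j + \<delta> * c j + \<delta> / 4) (\<delta> / 2)"
  have B: "1/4 \<le> (x $ j - a $ j) / \<delta> - c j \<and> (x $ j - a $ j) / \<delta> - c j \<le> 3/4" if "x \<in> B" for x j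
  proof -
    have "a $ j + \<delta> * c j + \<delta> / 4 \<le> x $ j" "x $ j < a $ j + \<delta> * c j + \<delta> / 4 + \<delta> / 2"
      using that by (auto simp: B_def half_open_cube_def)
    then show ?thesis
      using assms(1) by (auto simp: field_simps)
  qed
  have "B \<subseteq> grid_cell a \<delta> c"
  proof
    fix x assume "x \<in> B"
    then have "real (c j) \<le> (x $ j - a $ j) / \<delta>" "(x $ j - a $ j) / \<delta> < real (c j) + 1" for j
      using B[of x j] by linarith+
    then show "x \<in> grid_cell a \<delta> c"
      by (simp add: grid_cell_def floor_eq_iff)
  qed
  then have BU: "B \<subseteq> U" using assms(3) by simp
  have low: "\<kappa> ^ CARD('d) \<le> bump a \<delta> c x" if "x \<in> B" for x
  proof -
    have "(\<Prod>j\<in>(UNIV :: 'd set). \<kappa>) \<le> bump a \<delta> c x"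
      unfolding bump_def using B[OF that] \<kappa>_pos by (intro prod_mono) (auto intro: g_lower)
    then show ?thesis by simp
  qed
  have "measure lebesgue B = (\<delta> / 2) ^ CARD('d)"
    unfolding B_def using assms(1) by (intro measure_half_open_cube) simp
  then have "(\<kappa> / 2 * \<delta>) ^ CARD('d) = \<kappa> ^ CARD('d) * measure lebesgue B"
    by (simp only: power_mult_distrib power_divide times_divide_eq_left times_divide_eq_right)
  also have "\<dots> = (\<integral>x. \<kappa> ^ CARD('d) * indicat_real B x \<partial>lebesgue)"
    by simp
  also have "\<dots> \<le> weight U a \<delta> c"
    unfolding weight_def
  proof (intro integral_mono integrable_weight assms integrable_mult_right)
    show "integrable lebesgue (indicat_real B)"
      by (simp add: B_def integrable_indicator_fmeasurable)
    show "\<kappa> ^ CARD('d) * indicat_real B x \<le> indicat_real U x * bump a \<delta> c x" for x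
      using low[of x] BU bump_nonneg[of a \<delta> c x] by (auto simp: indicator_def)
  qed
  finally show ?thesis .
qed

lemma times_differentiable_rescale:
  "times_differentiable n f \<Longrightarrow> times_differentiable n (\<lambda>t. f ((t - a) / \<delta> - r))"
  using times_differentiable_affine[of n f "1 / \<delta>" "- a / \<delta> - r"]
  by (simp add: diff_divide_distrib algebra_simps)

text \<open>The difference of the two bumps is the \<open>i\<close>-th partial derivative of a test function that
  is bounded by \<open>\<delta>\<close> and supported in the row of cells through \<open>c\<close> in direction \<open>i\<close>.\<close>

lemma weight_diff_le:
  fixes U :: "(real^'d::finite) set" and c :: "'d \<Rightarrow> nat"
  assumes U: "U \<in> sets lebesgue" and grad: "has_distr_gradient (indicat_real U) \<mu>"
    and fin: "total_variation \<mu> UNIV < \<infinity>" and \<delta>: "0 < \<delta>" and ct: "c i < N" "t < N"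
  shows "\<bar>weight U a \<delta> c - weight U a \<delta> (c(i := t))\<bar> \<le>
    \<delta> * component_variation \<mu> i (\<Union>s<N. grid_cell a \<delta> (c(i := s)))"
proof -
  let ?T = "\<Union>s<N. grid_cell a \<delta> (c(i := s))"
  \<comment> \<open>To the left of the row both antiderivatives are 0, to the right both equal
    \<open>H 1\<close>; their difference therefore lives in the row.\<close>
  define D where "D = (\<lambda>y. H ((y - a $ i) / \<delta> - c i) - H ((y - a $ i) / \<delta> - t))"
  \<comment> \<open>The factor \<delta> in coordinate \<open>i\<close> cancels the 1/\<delta> that
    the chain rule produces.\<close>
  define h where "h = (\<lambda>j. if j = i then (\<lambda>y. \<delta> * D y) else (\<lambda>y. g ((y - a $ j) / \<delta> - c j)))"
  define dg where "dg = (\<lambda>y. g ((y - a $ i) / \<delta> - c i) - g ((y - a $ i) / \<delta> - t))"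
  define \<phi> :: "real^'d \<Rightarrow> real" where "\<phi> = (\<lambda>x. \<Prod>j\<in>UNIV. h j (x $ j))"
  have smooth_D: "times_differentiable n D" for n
  proof -
    have D_eq: "D = (\<lambda>y. H ((y - a $ i) / \<delta> - c i) + (-1) * H ((y - a $ i) / \<delta> - t))"
      by (simp add: D_def)
    show ?thesis
      unfolding D_eq by (intro times_differentiable_add times_differentiable_mult times_differentiable_const
          times_differentiable_rescale smooth_H)
  qed
  have smooth_h: "times_differentiable n (h j)" for n j
    by (auto simp: h_def intro!: times_differentiable_mult times_differentiable_const
        times_differentiable_rescale smooth_g smooth_D)
  have D_supp: "0 < (y - a $ i) / \<delta> \<and> (y - a $ i) / \<delta> < N" if "D y \<noteq> 0" for y
  proof (rule ccontr)
    assume "\<not> ?thesis"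
    then consider "(y - a $ i) / \<delta> \<le> 0" | "real N \<le> (y - a $ i) / \<delta>" by linarith
    then have "D y = 0"
    proof cases
      case 1
      then show ?thesis by (simp add: D_def H_left)
    next
      case 2
      moreover have "real (c i) + 1 \<le> N" "real t + 1 \<le> N" using ct by auto
      ultimately show ?thesis
        unfolding D_def by (subst (1 2) H_right) auto
    qed
    with that show False by simp
  qed
  have D_le: "\<bar>D y\<bar> \<le> 1" for y
    using H_nonneg H_le_1 unfolding D_def by (smt (verit))
  have g_supp: "0 < s \<and> s < 1" if "g s \<noteq> 0" for s
    using that g_support[of s] by linarith
  have "test_function \<phi>"
    unfolding \<phi>_def
  proof (rule test_function_prod_components[OF smooth_h])
    fix j y assume "h j y \<noteq> 0"
    \<comment> \<open>The bound \<open>N\<close> is for coordinate \<open>i\<close>. In the other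
      coordinates the support ends at \<open>c j + 1\<close>, which may exceed
      \<open>N\<close>.\<close>
    then have "0 \<le> (y - a $ j) / \<delta> \<and> (y - a $ j) / \<delta> \<le> max (real N) (c j + 1)"
      using D_supp[of y] g_supp[of "(y - a $ j) / \<delta> - c j"] by (auto simp: h_def split: if_splits)
    then show "a $ j \<le> y \<and> y \<le> a $ j + \<delta> * max (real N) (c j + 1)"
      using \<delta> by (auto simp: field_simps max_def zero_le_divide_iff split: if_splits)
  qed
  moreover have pd: "partial_deriv i \<phi> = (\<lambda>x. bump a \<delta> c x - bump a \<delta> (c(i := t)) x)"
  proof -
    \<comment> \<open>\<open>partial_deriv_prod_components\<close> asks for derivatives of all
      factors. Those in \<open>h0\<close> are arbitrary witnesses, and the explicit
      \<open>dg\<close> is put in at \<open>i\<close>.\<close>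
    have "\<exists>h'. \<forall>y. (h j has_real_derivative h' y) (at y)" for j
      using smooth_h[of 1 j] by auto
    then obtain h0 where h0: "\<And>j y. (h j has_real_derivative h0 j y) (at y)"
      by metis
    have dH: "((\<lambda>y. H ((y - a $ i) / \<delta> - r)) has_real_derivative g ((y - a $ i) / \<delta> - r) * (1 / \<delta>)) (at y)"
      for y r
      using \<delta> by (intro DERIV_chain2[OF deriv_H]) (auto intro!: derivative_eq_intros)
    have "((\<lambda>y. \<delta> * D y) has_real_derivative
        \<delta> * (g ((y - a $ i) / \<delta> - c i) * (1 / \<delta>) - g ((y - a $ i) / \<delta> - t) * (1 / \<delta>))) (at y)" for y
      unfolding D_def by (intro DERIV_cmult DERIV_diff dH)
    then have "(h i has_real_derivative dg y) (at y)" for y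
      using \<delta> by (simp add: h_def dg_def right_diff_distrib)
    with h0 have "((h j) has_real_derivative (h0(i := dg)) j y) (at y)" for j y
      by simp
    from partial_deriv_prod_components[of h "h0(i := dg)", OF this, of i]
    have "partial_deriv i \<phi> = (\<lambda>x. \<Prod>j\<in>UNIV. (h(i := dg)) j (x $ j))"
      by (simp add: \<phi>_def)
    moreover have "(\<Prod>j\<in>UNIV. (h(i := dg)) j (x $ j)) = bump a \<delta> c x - bump a \<delta> (c(i := t)) x" for x
    proof -
      have "(\<Prod>j\<in>UNIV. (h(i := dg)) j (x $ j)) =
          dg (x $ i) * (\<Prod>j\<in>UNIV - {i}. g ((x $ j - a $ j) / \<delta> - c j))"
        by (subst prod.remove[of UNIV i]) (auto simp: h_def intro!: prod.cong)
      moreover have "bump a \<delta> c x =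
          g ((x $ i - a $ i) / \<delta> - c i) * (\<Prod>j\<in>UNIV - {i}. g ((x $ j - a $ j) / \<delta> - c j))"
        unfolding bump_def by (subst prod.remove[of UNIV i]) auto
      moreover have "bump a \<delta> (c(i := t)) x =
          g ((x $ i - a $ i) / \<delta> - t) * (\<Prod>j\<in>UNIV - {i}. g ((x $ j - a $ j) / \<delta> - c j))"
        unfolding bump_def by (subst prod.remove[of UNIV i]) (auto intro!: prod.cong)
      ultimately show ?thesis by (simp add: dg_def left_diff_distrib)
    qed
    ultimately show ?thesis by simp
  qed
  ultimately have "(\<integral>x. indicat_real U x * (bump a \<delta> c x - bump a \<delta> (c(i := t)) x) \<partial>lebesgue) =
      - signed_integral (\<lambda>A. \<mu> A $ i) \<phi>"
    using grad unfolding has_distr_gradient_def by metis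
  moreover have "(\<integral>x. indicat_real U x * (bump a \<delta> c x - bump a \<delta> (c(i := t)) x) \<partial>lebesgue) =
      weight U a \<delta> c - weight U a \<delta> (c(i := t))"
    unfolding weight_def using \<delta> U
    by (simp add: right_diff_distrib Bochner_Integration.integral_diff integrable_weight)
  moreover have "\<bar>signed_integral (\<lambda>A. \<mu> A $ i) \<phi>\<bar> \<le> \<delta> * component_variation \<mu> i ?T"
  proof (rule abs_signed_integral_le[OF _ _ fin])
    have "(h j has_real_derivative h' y) (at y) \<Longrightarrow> isCont (h j) y" for h' j y
      by (rule DERIV_isCont)
    then have "continuous_on UNIV (h j)" for j
      using smooth_h[of 1 j] by (auto simp: continuous_on_eq_continuous_at)
    then have [measurable]: "h j \<in> borel_measurable borel" for j
      by (rule borel_measurable_continuous_onI)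
    show "\<phi> \<in> borel_measurable borel"
      unfolding \<phi>_def by measurable
    show "?T \<in> sets borel"
      using \<delta> by auto
    show "\<bar>\<phi> x\<bar> \<le> \<delta> * indicator ?T x" for x
    proof (cases "\<phi> x = 0")
      case False
      then have nz: "h j (x $ j) \<noteq> 0" for j
        by (auto simp: \<phi>_def)
      \<comment> \<open>The position along the row of the cell containing \<open>x\<close>;
        \<open>D_supp\<close> places it between 0 and \<open>N\<close>.\<close>
      define s where "s = nat \<lfloor>(x $ i - a $ i) / \<delta>\<rfloor>"
      have Di: "D (x $ i) \<noteq> 0" using nz[of i] by (simp add: h_def)
      have "x \<in> grid_cell a \<delta> (c(i := s))"
        unfolding grid_cell_def
      proof (intro CollectI allI)
        fix j show "\<lfloor>(x $ j - a $ j) / \<delta>\<rfloor> = int ((c(i := s)) j)"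
        proof (cases "j = i")
          case True
          then show ?thesis using D_supp[OF Di] by (simp add: s_def)
        next
          case False
          then show ?thesis
            using nz[of j] g_supp[of "(x $ j - a $ j) / \<delta> - c j"] by (simp add: h_def floor_eq_iff)
        qed
      qed
      moreover have "s < N"
        using D_supp[OF Di] by (auto simp: s_def nat_less_iff floor_less_iff)
      ultimately have "x \<in> ?T" by blast
      moreover have "\<bar>\<phi> x\<bar> \<le> \<delta>"
      proof -
        have "\<bar>\<phi> x\<bar> = (\<delta> * \<bar>D (x $ i)\<bar>) * (\<Prod>j\<in>UNIV - {i}. \<bar>g ((x $ j - a $ j) / \<delta> - c j)\<bar>)"
          unfolding \<phi>_def abs_prod using \<delta>
          by (subst prod.remove[of UNIV i]) (auto simp: h_def abs_mult intro!: prod.cong)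
        also have "\<dots> \<le> (\<delta> * 1) * 1"
          using \<delta> D_le g_nonneg g_le_1 by (intro mult_mono prod_le_1) (auto intro!: prod_nonneg)
        finally show ?thesis by simp
      qed
      ultimately show ?thesis by simp
    qed (use \<delta> in simp)
  qed
  ultimately show ?thesis by linarith
qed

end

text \<open>Inner regularity gives a compact part of the intersection with at least half of its
  measure. It has positive distance from the complement of \<open>U\<close>, so once the cells are
  smaller than this distance, every cell meeting it lies in \<open>U\<close>.\<close>

lemma exists_grid_cells_filling_half:
  fixes U :: "(real^'d::finite) set"
  assumes "open U" "0 < l"
  obtains N where "0 < N" "measure lebesgue (U \<inter> half_open_cube a l) / 2 \<le>
    card {c \<in> grid_index N. grid_cell a (l / N) c \<subseteq> U} * (l / real N) ^ CARD('d)"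
proof (cases "measure lebesgue (U \<inter> half_open_cube a l) = 0")
  case True
  then show ?thesis using that[of 1] assms(2) by simp
next
  case False
  let ?P = "half_open_cube a l"
  let ?V = "measure lebesgue (U \<inter> ?P)"
  have V: "0 < ?V" using False by (simp add: zero_less_measure_iff)
  have fm: "U \<inter> ?P \<in> lmeasurable"
    by (rule fmeasurableI2[of ?P]) (use assms in auto)
  obtain T where T: "closed T" "T \<subseteq> U \<inter> ?P" "U \<inter> ?P - T \<in> lmeasurable"
      "emeasure lebesgue (U \<inter> ?P - T) < ennreal (?V / 2)"
    using sets_lebesgue_inner_closed[of "U \<inter> ?P" "?V / 2"] fm V by auto
  have "bounded T" using bounded_subset[OF bounded_half_open_cube] T(2) by blast
  then have "compact T" using T(1) by (simp add: compact_eq_bounded_closed)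
  then have Tm: "T \<in> lmeasurable" by (rule lmeasurable_compact)
  have "measure lebesgue (U \<inter> ?P - T) < ?V / 2"
    using T(3,4) V by (simp add: emeasure_eq_measure2 ennreal_less_iff)
  then have half: "?V / 2 \<le> measure lebesgue T"
    using measurable_measure_Diff[OF fm, of T] Tm T(2) by (simp add: fmeasurableD)
  obtain e where e: "0 < e" "\<forall>x\<in>T. \<forall>y\<in>-U. e \<le> dist x y"
    using separate_compact_closed[OF \<open>compact T\<close>, of "- U"] assms(1) T(2) by auto
  obtain N where "CARD('d) * l / e < real N" using reals_Archimedean2 by blast
  moreover from this have N: "0 < N"
    using e(1) assms(2) by (cases "N = 0") (auto simp: divide_less_0_iff mult_less_0_iff)
  ultimately have small: "CARD('d) * (l / N) < e" using e(1) by (simp add: field_simps)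
  let ?G = "{c \<in> grid_index N. grid_cell a (l / N) c \<subseteq> U}"
  have "T \<subseteq> (\<Union>c\<in>?G. grid_cell a (l / N) c)"
  proof
    fix x assume x: "x \<in> T"
    then obtain c where c: "c \<in> grid_index N" "x \<in> grid_cell a (l / N) c"
      using T(2) Union_grid_cell[OF assms(2) N, of a] by blast
    have "grid_cell a (l / N) c \<subseteq> ball x e"
      using c(2) half_open_cube_subset_ball[OF _ small] grid_cell_eq_half_open_cube[of "l / N" a c] assms(2) N
      by simp
    moreover have "ball x e \<subseteq> U" using e(2) x by force
    ultimately have "grid_cell a (l / N) c \<subseteq> U" by blast
    with c show "x \<in> (\<Union>c\<in>?G. grid_cell a (l / N) c)" by blast
  qed
  then have "measure lebesgue T \<le> measure lebesgue (\<Union>c\<in>?G. grid_cell a (l / N) c)"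
    using assms(2) N by (intro measure_mono_fmeasurable fmeasurable.finite_UN fmeasurableD[OF Tm])
      (auto simp: grid_cell_eq_half_open_cube)
  also have "\<dots> \<le> (\<Sum>c\<in>?G. measure lebesgue (grid_cell a (l / N) c))"
    using assms(2) N by (intro measure_UNION_le) (auto simp: grid_cell_eq_half_open_cube)
  also have "\<dots> = (\<Sum>c\<in>?G. (l / N) ^ CARD('d))"
  proof (rule sum.cong)
    fix c
    show "measure lebesgue (grid_cell a (l / N) c) = (l / N) ^ CARD('d)"
      using assms(2) N by (subst grid_cell_eq_half_open_cube) (simp, intro measure_half_open_cube, simp)
  qed simp
  finally show ?thesis
    using half N by (intro that[of N]) simp_all
qed

context smooth_bump begin

text \<open>The row estimates are split into cells, and the cells of the cube together carry at most
  \<open>2 * v\<close> in each direction. The number \<open>N\<close> of cells in a row times the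
  mesh size gives \<open>l\<close>, so the bound per pair of cells improves with the grid.\<close>

lemma sum_weight_diff_le:
  fixes U :: "(real^'d::finite) set" and N :: nat and l :: real
  assumes U: "U \<in> sets lebesgue" and grad: "has_distr_gradient (indicat_real U) \<mu>"
    and fin: "total_variation \<mu> UNIV < \<infinity>" and l: "0 < l" and N: "0 < N"
    and v: "total_variation \<mu> (half_open_cube a l) = ennreal v" "0 \<le> v"
  shows "(\<Sum>c\<in>grid_index N. \<Sum>c'\<in>grid_index N. \<bar>weight U a (l / N) c - weight U a (l / N) c'\<bar>) \<le>
    real N ^ CARD('d) * (2 * CARD('d) * l * v)"
proof -
  let ?K = "grid_index N :: ('d \<Rightarrow> nat) set" and ?\<delta> = "l / N"
  let ?m = "\<lambda>i c. ?\<delta> * component_variation \<mu> i (grid_cell a ?\<delta> c)"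
  have \<delta>: "0 < ?\<delta>" using l N by simp
  have "(\<Sum>c\<in>?K. \<Sum>c'\<in>?K. \<bar>weight U a ?\<delta> c - weight U a ?\<delta> c'\<bar>) \<le>
      real N ^ CARD('d) * (N * (\<Sum>i\<in>UNIV. \<Sum>c\<in>?K. ?m i c))"
  proof (rule sum_abs_diff_grid_le)
    fix c :: "'d \<Rightarrow> nat" and i t assume "c \<in> ?K" "t < N"
    then have "\<bar>weight U a ?\<delta> c - weight U a ?\<delta> (c(i := t))\<bar> \<le>
        ?\<delta> * component_variation \<mu> i (\<Union>s<N. grid_cell a ?\<delta> (c(i := s)))"
      by (intro weight_diff_le U grad fin \<delta>) (auto simp: grid_index_def)
    also have "\<dots> \<le> ?\<delta> * (\<Sum>s<N. component_variation \<mu> i (grid_cell a ?\<delta> (c(i := s))))"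
      unfolding component_variation_def sum.distrib using \<delta>
      by (intro mult_left_mono add_mono measure_UNION_le) auto
    finally show "\<bar>weight U a ?\<delta> c - weight U a ?\<delta> (c(i := t))\<bar> \<le> (\<Sum>s<N. ?m i (c(i := s)))"
      by (simp only: sum_distrib_left)
  qed
  also have "\<dots> \<le> real N ^ CARD('d) * (N * (\<Sum>i\<in>(UNIV :: 'd set). ?\<delta> * (2 * v)))"
  proof (intro mult_left_mono sum_mono)
    fix i :: 'd
    have "(\<Sum>c\<in>?K. component_variation \<mu> i (grid_cell a ?\<delta> c)) \<le> component_variation \<mu> i (half_open_cube a l)"
      using \<delta> Union_grid_cell[OF l N, of a]
      by (intro component_variation_sum_le fin disjoint_family_grid_cell) auto
    also have "\<dots> \<le> 2 * v"
      by (intro component_variation_le v) simp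
    finally show "(\<Sum>c\<in>?K. ?m i c) \<le> ?\<delta> * (2 * v)"
      unfolding sum_distrib_left[symmetric] using \<delta> by (intro mult_left_mono) auto
  qed auto
  also have "\<dots> = real N ^ CARD('d) * (2 * CARD('d) * l * v)"
    using N by simp
  finally show ?thesis .
qed

text \<open>Pairs of cells are counted whose first member lies in \<open>U\<close>. One factor
  \<theta> of the constant comes from the gap between the weight of such a cell and the average, the
  other from the number of such cells, via \<open>lower\<close>.\<close>

lemma relative_isoperimetric:
  fixes U :: "(real^'d::finite) set" and l \<theta> v :: real
  assumes U: "open U" and grad: "has_distr_gradient (indicat_real U) \<mu>"
    and fin: "total_variation \<mu> UNIV < \<infinity>" and l: "0 < l"
    and v: "total_variation \<mu> (half_open_cube a l) = ennreal v" "0 \<le> v"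
    and \<theta>: "\<theta> = (\<kappa> / 2) ^ CARD('d) / 2"
    and lower: "\<theta> / 2 ^ CARD('d) * l ^ CARD('d) \<le> measure lebesgue (U \<inter> half_open_cube a l)"
    and upper: "measure lebesgue (U \<inter> half_open_cube a l) \<le> \<theta> * l ^ CARD('d)"
  shows "l ^ (CARD('d) - 1) \<le> 4 * 2 ^ CARD('d) * CARD('d) / \<theta>\<^sup>2 * v"
proof -
  let ?d = "CARD('d)" and ?P = "half_open_cube a l"
  let ?V = "measure lebesgue (U \<inter> ?P)"
  have U': "U \<in> sets lebesgue" using U by simp
  have \<theta>_pos: "0 < \<theta>" unfolding \<theta> using \<kappa>_pos by simp
  obtain N where N: "0 < N" and half: "?V / 2 \<le>
      card {c \<in> grid_index N. grid_cell a (l / N) c \<subseteq> U} * (l / real N) ^ ?d"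
    by (rule exists_grid_cells_filling_half[OF U l])
  let ?K = "grid_index N :: ('d \<Rightarrow> nat) set" and ?\<delta> = "l / N"
  let ?G = "{c \<in> ?K. grid_cell a ?\<delta> c \<subseteq> U}"
  have \<delta>: "0 < ?\<delta>" using l N by simp
  have N\<delta>: "real N ^ ?d * ?\<delta> ^ ?d = l ^ ?d" using N by (simp add: power_divide)
  have "(\<Sum>c\<in>?K. weight U a ?\<delta> c) \<le> (\<Sum>c\<in>?K. measure lebesgue (U \<inter> grid_cell a ?\<delta> c))"
    by (intro sum_mono weight_le \<delta> U')
  also have "\<dots> \<le> ?V"
  proof (rule sum_measure_le)
    show "disjoint_family_on (\<lambda>c. U \<inter> grid_cell a ?\<delta> c) ?K"
      using disjoint_family_grid_cell[of a ?\<delta> ?K] by (auto simp: disjoint_family_on_def)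
    show "U \<inter> grid_cell a ?\<delta> c \<in> sets lebesgue" for c
      using U' \<delta> by (intro sets.Int) simp_all
    show "(\<Union>c\<in>?K. U \<inter> grid_cell a ?\<delta> c) \<subseteq> U \<inter> ?P"
      using Union_grid_cell[OF l N, of a] by blast
    show "U \<inter> ?P \<in> lmeasurable"
      by (rule fmeasurableI2[of ?P]) (use U' in auto)
  qed simp
  finally have sum_le: "(\<Sum>c\<in>?K. weight U a ?\<delta> c) \<le> ?V" .
  have row: "\<theta> * l ^ ?d \<le> (\<Sum>c'\<in>?K. \<bar>weight U a ?\<delta> c - weight U a ?\<delta> c'\<bar>)" if "c \<in> ?G" for c
  proof -
    \<comment> \<open>The value of \<theta> is chosen for this identity: \<open>N ^ d\<close> copies
      of the weight of a full cell reach twice the bound \<open>upper\<close> for the sum of all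
      weights.\<close>
    have "2 * \<theta> * l ^ ?d = real N ^ ?d * (\<kappa> / 2 * ?\<delta>) ^ ?d"
      unfolding N\<delta>[symmetric] \<theta> power_mult_distrib[of "\<kappa> / 2"] by simp
    also have "\<dots> \<le> real N ^ ?d * weight U a ?\<delta> c"
      using that by (intro mult_left_mono weight_ge \<delta> U') auto
    finally have "\<theta> * l ^ ?d \<le> real N ^ ?d * weight U a ?\<delta> c - (\<Sum>c'\<in>?K. weight U a ?\<delta> c')"
      using sum_le upper by linarith
    also have "\<dots> = (\<Sum>c'\<in>?K. weight U a ?\<delta> c - weight U a ?\<delta> c')"
      by (simp add: sum_subtractf card_grid_index)
    also have "\<dots> \<le> (\<Sum>c'\<in>?K. \<bar>weight U a ?\<delta> c - weight U a ?\<delta> c'\<bar>)"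
      by (intro sum_mono) simp
    finally show ?thesis .
  qed
  have "card ?G * (\<theta> * l ^ ?d) = (\<Sum>c\<in>?G. \<theta> * l ^ ?d)"
    by simp
  also have "\<dots> \<le> (\<Sum>c\<in>?G. \<Sum>c'\<in>?K. \<bar>weight U a ?\<delta> c - weight U a ?\<delta> c'\<bar>)"
    by (intro sum_mono row)
  also have "\<dots> \<le> (\<Sum>c\<in>?K. \<Sum>c'\<in>?K. \<bar>weight U a ?\<delta> c - weight U a ?\<delta> c'\<bar>)"
    by (intro sum_mono2) (auto intro: sum_nonneg)
  also have "\<dots> \<le> real N ^ ?d * (2 * ?d * l * v)"
    by (rule sum_weight_diff_le[OF U' grad fin l N v])
  \<comment> \<open>Multiplying by the volume of a cell makes \<open>l ^ d\<close> appear on both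
    sides, and the number of cells drops out.\<close>
  finally have "card ?G * (\<theta> * l ^ ?d) * ?\<delta> ^ ?d \<le> real N ^ ?d * (2 * ?d * l * v) * ?\<delta> ^ ?d"
    using \<delta> by (intro mult_right_mono) auto
  then have "(card ?G * ?\<delta> ^ ?d * \<theta>) * l ^ ?d \<le> (real N ^ ?d * ?\<delta> ^ ?d) * (2 * ?d * l * v)"
    by (simp only: mult_ac)
  then have "(card ?G * ?\<delta> ^ ?d * \<theta>) * l ^ ?d \<le> (2 * ?d * l * v) * l ^ ?d"
    unfolding N\<delta> by (simp only: mult_ac)
  then have main: "card ?G * ?\<delta> ^ ?d * \<theta> \<le> 2 * ?d * l * v"
    using l by (simp only: mult_le_cancel_right_pos zero_less_power)
  have "\<theta> / 2 ^ ?d * l ^ ?d / 2 * \<theta> \<le> card ?G * ?\<delta> ^ ?d * \<theta>"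
    using half divide_right_mono[OF lower, of 2] \<theta>_pos
    by (intro mult_right_mono order_trans[OF _ half]) auto
  with main have "\<theta> / 2 ^ ?d * l ^ ?d / 2 * \<theta> \<le> 2 * ?d * l * v"
    by linarith
  \<comment> \<open>One factor \<open>l\<close> cancels against the one in \<open>main\<close>,
    which leaves the exponent of the claim.\<close>
  moreover have "l ^ ?d = l * l ^ (?d - 1)"
    by (simp flip: power_Suc)
  ultimately have "l * (\<theta> / 2 ^ ?d * l ^ (?d - 1) / 2 * \<theta>) \<le> l * (2 * ?d * v)"
    by (simp add: mult_ac)
  then have "\<theta> / 2 ^ ?d * l ^ (?d - 1) / 2 * \<theta> \<le> 2 * ?d * v"
    using l by (simp only: mult_le_cancel_left_pos)
  then show ?thesis
    using \<theta>_pos by (simp add: field_simps power2_eq_square)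
qed

end

section \<open>Selection of dyadic cubes\<close>

text \<open>Reflection at the upper bound \<open>K\<close> turns a greatest integer into a least
  natural number.\<close>

lemma int_greatest_exists:
  fixes P :: "int \<Rightarrow> bool"
  assumes "P k" "\<And>m. P m \<Longrightarrow> m \<le> K"
  obtains m where "P m" "\<And>n. P n \<Longrightarrow> n \<le> m"
proof -
  define n where "n = (LEAST n. P (K - int n))"
  have "P (K - int (nat (K - k)))" using assms by simp
  then have "P (K - int n)" unfolding n_def by (rule LeastI)
  moreover have "m \<le> K - int n" if "P m" for m
  proof -
    have "P (K - int (nat (K - m)))" using assms(2)[OF that] that by simp
    then have "n \<le> nat (K - m)" unfolding n_def by (rule Least_le)
    then show ?thesis using assms(2)[OF that] by linarith
  qed
  ultimately show ?thesis by (rule that)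
qed

text \<open>This bounds the generation of any cube that contains a fixed proportion of a set of
  finite volume. Once \<open>2 powi k\<close> is at least 1, its n-th power dominates it.\<close>

lemma powi_2_bounded_above:
  assumes "0 < n" "0 < \<epsilon>"
  obtains K where "\<And>k. \<epsilon> * (2 powi k) ^ n \<le> (V :: real) \<Longrightarrow> k \<le> K"
proof -
  obtain m where m: "V / \<epsilon> < 2 ^ m" using real_arch_pow[of 2 "V / \<epsilon>"] by auto
  have "k \<le> int m" if "\<epsilon> * (2 powi k) ^ n \<le> V" for k
  proof (rule ccontr)
    assume "\<not> k \<le> int m"
    then have le: "(2 :: real) ^ m \<le> 2 powi k"
      using power_int_increasing[of "int m" k "2 :: real"] by simp
    have "(1 :: real) \<le> 2 ^ m" by simp
    then have "(1 :: real) \<le> 2 powi k" using le by (rule order_trans)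
    then have "((2 :: real) powi k) ^ 1 \<le> (2 powi k) ^ n"
      using assms(1) by (intro power_increasing) auto
    with le have "2 ^ m \<le> (2 powi k :: real) ^ n" by simp
    then have "V < \<epsilon> * (2 powi k) ^ n"
      using m assms(2) by (simp add: pos_divide_less_eq mult.commute) (smt (verit) mult_left_mono)
    with that show False by simp
  qed
  then show ?thesis by (rule that)
qed

text \<open>The largest dyadic cubes in which \<open>U\<close> has density comparable to \<open>\<theta>\<close>. The first cube,
  going up from a small one inside \<open>U\<close>, where the density drops to at most \<open>\<theta>\<close> has density at
  least \<open>\<theta> / 2\<^sup>d\<close>, because its child has density above \<open>\<theta>\<close>.\<close>

lemma dyadic_cover:
  fixes U :: "(real^'d::finite) set"
  assumes dyadic: "dyadic_system \<D>" and U: "open U" "bounded U" and \<theta>: "0 < \<theta>" "\<theta> < 1"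
  obtains M where "M \<subseteq> \<D>" "countable M" "disjoint M" "U \<subseteq> \<Union>M"
    "\<And>Q. Q \<in> M \<Longrightarrow> \<exists>a l. 0 < l \<and> Q = half_open_cube a l \<and>
       \<theta> / 2 ^ CARD('d) * l ^ CARD('d) \<le> measure lebesgue (U \<inter> Q) \<and>
       measure lebesgue (U \<inter> Q) \<le> \<theta> * l ^ CARD('d)"
proof -
  let ?d = "CARD('d)"
  obtain D :: "int \<Rightarrow> (real^'d) set set" where \<D>: "\<D> = (\<Union>k. D k)"
    and part: "\<And>k. partition_on UNIV (D k)"
    and cube: "\<And>k Q. Q \<in> D k \<Longrightarrow> \<exists>a. Q = half_open_cube a (2 powi k)"
    and children: "\<And>k Q. Q \<in> D k \<Longrightarrow> \<exists>S\<subseteq>D (k - 1). card S = 2 ^ ?d \<and> Q = \<Union>S"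
    using dyadic unfolding dyadic_system_def by blast
  define V where "V Q = measure lebesgue (U \<inter> Q)" for Q
  \<comment> \<open>The cube of generation \<open>k\<close> around \<open>x\<close>; by
    \<open>q_eq\<close> it is the only one, and it increases with \<open>k\<close>.\<close>
  define q where "q k x = (SOME Q. Q \<in> D k \<and> x \<in> Q)" for k x
  have "\<exists>Q. Q \<in> D k \<and> x \<in> Q" for k x
    using part[of k] by (auto simp: partition_on_def)
  then have q: "q k x \<in> D k" "x \<in> q k x" for k x
    unfolding q_def by (metis (mono_tags, lifting) someI_ex)+
  have q_eq: "Q = q k x" if "Q \<in> D k" "x \<in> Q" for Q k x
    using part[of k] q(1)[of k x] q(2)[of x k] that by (auto simp: partition_on_def disjoint_def)
  have q_step: "q k x \<subseteq> q (k + 1) x" for k x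
  proof -
    obtain S where S: "S \<subseteq> D k" "q (k + 1) x = \<Union>S"
      using children[OF q(1), of "k + 1" x] by auto
    then obtain R where "R \<in> S" "x \<in> R" using q(2)[of x "k + 1"] by auto
    with S show ?thesis using q_eq[of R k x] by auto
  qed
  have q_add: "q k x \<subseteq> q (k + int n) x" for k x n
  proof (induction n)
    case (Suc n)
    then show ?case using q_step[of "k + int n" x] by (simp add: algebra_simps)
  qed simp
  have q_mono: "q k x \<subseteq> q m x" if "k \<le> m" for k m x
    using q_add[of k x "nat (m - k)"] that by simp
  have Um: "U \<in> lmeasurable"
    using U by (intro bounded_set_imp_lmeasurable) auto
  have cube_sets: "Q \<in> sets lebesgue" if "Q \<in> D k" for Q k
    using cube[OF that] by auto
  have V_mono: "V Q \<le> V R" if "Q \<subseteq> R" "Q \<in> D k" "R \<in> D m" for Q R k m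
    unfolding V_def using that cube_sets Um
    by (intro measure_mono_fmeasurable fmeasurable_Int_fmeasurable sets.Int) (auto simp: fmeasurableD)
  have V_le: "V Q \<le> measure lebesgue U" if "Q \<in> D k" for Q k
    unfolding V_def using that cube_sets Um
    by (intro measure_mono_fmeasurable sets.Int) (auto simp: fmeasurableD)
  define good where "good k Q \<longleftrightarrow> \<theta> / 2 ^ ?d * (2 powi k) ^ ?d \<le> V Q \<and> V Q \<le> \<theta> * (2 powi k) ^ ?d" for k Q
  \<comment> \<open>The lower density bound limits the size of a good cube, as \<open>U\<close> has
    finite measure.\<close>
  have good_bounded: "\<exists>K. \<forall>k x. good k (q k x) \<longrightarrow> k \<le> K"
  proof -
    obtain K where K: "\<And>k. \<theta> / 2 ^ ?d * (2 powi k) ^ ?d \<le> measure lebesgue U \<Longrightarrow> k \<le> K"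
      using powi_2_bounded_above[of ?d "\<theta> / 2 ^ ?d" "measure lebesgue U"] \<theta> by auto
    show ?thesis
      using K V_le[OF q(1)] unfolding good_def by (meson order_trans)
  qed
  have good_exists: "\<exists>k. good k (q k x)" if x: "x \<in> U" for x
  proof -
    obtain e where e: "0 < e" "ball x e \<subseteq> U" using U(1) x by (auto simp: open_contains_ball)
    obtain n where n: "(1 / 2) ^ n < e / ?d"
      using real_arch_pow_inv[of "e / ?d" "1 / 2"] e(1) by auto
    \<comment> \<open>At this scale the cube around \<open>x\<close> lies inside \<open>U\<close>,
      so its density is 1, which exceeds \<theta>.\<close>
    define k0 where "k0 = - int n"
    have "?d * 2 powi k0 < e"
      using n by (simp add: k0_def power_int_minus power_one_over field_simps)
    moreover obtain a where a: "q k0 x = half_open_cube a (2 powi k0)" using cube[OF q(1)] by blast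
    ultimately have "q k0 x \<subseteq> U"
      using half_open_cube_subset_ball[of x a "2 powi k0" e] q(2)[of x k0] e(2) by auto
    then have "V (q k0 x) = (2 powi k0) ^ ?d"
      unfolding V_def by (subst Int_absorb1) (simp_all only: a, intro measure_half_open_cube, simp)
    then have k0: "\<theta> * (2 powi k0) ^ ?d < V (q k0 x)"
      using \<theta> by simp
    obtain K where K: "\<And>k. \<theta> * (2 powi k) ^ ?d \<le> measure lebesgue U \<Longrightarrow> k \<le> K"
      using powi_2_bounded_above[of ?d \<theta> "measure lebesgue U"] \<theta> by auto
    \<comment> \<open>The last generation with density above \<theta>. Its parent has density at
      most \<theta> by maximality, and at least \<theta> / 2^d because it contains the child and has
      2^d times its volume.\<close>
    obtain k where k: "\<theta> * (2 powi k) ^ ?d < V (q k x)"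
      and k_max: "\<And>m. \<theta> * (2 powi m) ^ ?d < V (q m x) \<Longrightarrow> m \<le> k"
    proof (rule int_greatest_exists[of "\<lambda>k. \<theta> * (2 powi k) ^ ?d < V (q k x)" k0 K])
      show "m \<le> K" if "\<theta> * (2 powi m) ^ ?d < V (q m x)" for m
        using that V_le[OF q(1), of m x] by (intro K) simp
    qed (use k0 in blast)+
    have "(2 powi (k + 1) :: real) = 2 * 2 powi k" by (simp add: power_int_add)
    then have "\<theta> / 2 ^ ?d * (2 powi (k + 1)) ^ ?d = \<theta> * (2 powi k) ^ ?d"
      by (simp add: power_mult_distrib)
    moreover have "V (q k x) \<le> V (q (k + 1) x)"
      by (rule V_mono[OF q_step q(1) q(1)])
    ultimately have "good (k + 1) (q (k + 1) x)"
      using k k_max[of "k + 1"] unfolding good_def by force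
    then show ?thesis by blast
  qed
  define M where "M = {q k x |k x. x \<in> U \<and> good k (q k x) \<and> (\<forall>m. good m (q m x) \<longrightarrow> m \<le> k)}"
  have "disjoint M"
  proof -
    \<comment> \<open>Maximality around \<open>x\<close> alone suffices for the cube of the lower
      generation: the other cube shares the point \<open>z\<close> with it, hence contains it and is
      a good cube around \<open>x\<close>, so the generations agree.\<close>
    have *: "q k x = q m y" if "k \<le> m" "good m (q m y)" "\<forall>m. good m (q m x) \<longrightarrow> m \<le> k"
      "z \<in> q k x" "z \<in> q m y" for k m x y z
    proof -
      have "q k x = q k z" "q m y = q m z" using q_eq[OF q(1) that(4)] q_eq[OF q(1) that(5)] by auto
      moreover from this have "x \<in> q m z" using q(2)[of x k] q_mono[OF that(1), of z] by auto
      then have "q m z = q m x" by (rule q_eq[OF q(1)])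
      ultimately show ?thesis using that by auto
    qed
    have "q k x = q m y" if "good k (q k x)" "good m (q m y)" "\<forall>m. good m (q m x) \<longrightarrow> m \<le> k"
      "\<forall>k. good k (q k y) \<longrightarrow> k \<le> m" "z \<in> q k x" "z \<in> q m y" for k m x y z
      using *[of k m y x z] *[of m k x y z] that by (cases "k \<le> m") auto
    then show ?thesis
      unfolding disjoint_def M_def by blast
  qed
  have M_good: "\<exists>k. Q \<in> D k \<and> good k Q" if "Q \<in> M" for Q
    using that q(1) by (auto simp: M_def)
  show ?thesis
  proof (rule that)
    show "M \<subseteq> \<D>" using M_good \<D> by blast
    show "disjoint M" by fact
    show "countable M"
    \<comment> \<open>Every cube contains a nonempty open box, and disjoint sets with nonempty
      interior form a countable family.\<close>
    proof (rule countable_disjoint_nonempty_interior_subsets)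
      show "pairwise disjnt M" using \<open>disjoint M\<close> by (simp add: disjoint_def pairwise_def disjnt_def)
      fix Q assume "Q \<in> M" "interior Q = {}"
      moreover obtain k a where "Q = half_open_cube a (2 powi k)"
        using M_good[OF \<open>Q \<in> M\<close>] cube by blast
      ultimately have "box a (\<chi> j. a $ j + 2 powi k) = {}"
        using interior_maximal[OF half_open_cube_bounds(1) open_box, of a "2 powi k"] by simp
      then have "\<exists>j. a $ j + 2 powi k \<le> a $ j" by (simp add: interval_eq_empty_cart)
      then have "2 powi k \<le> (0 :: real)" by simp
      then show "Q = {}" using zero_less_power_int[of "2 :: real" k] by linarith
    qed
    show "U \<subseteq> \<Union>M"
    proof
      fix x assume x: "x \<in> U"
      obtain K where K: "\<And>k. good k (q k x) \<Longrightarrow> k \<le> K" using good_bounded by blast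
      obtain k0 where "good k0 (q k0 x)" using good_exists[OF x] by blast
      then obtain k where "good k (q k x)" "\<And>m. good m (q m x) \<Longrightarrow> m \<le> k"
        using int_greatest_exists[of "\<lambda>k. good k (q k x)" k0 K] K by blast
      with x have "q k x \<in> M" by (auto simp: M_def)
      then show "x \<in> \<Union>M" using q(2) by blast
    qed
    fix Q assume "Q \<in> M"
    then obtain k a where "good k Q" "Q = half_open_cube a (2 powi k)"
      using M_good cube by blast
    then show "\<exists>a l. 0 < l \<and> Q = half_open_cube a l \<and>
       \<theta> / 2 ^ ?d * l ^ ?d \<le> measure lebesgue (U \<inter> Q) \<and> measure lebesgue (U \<inter> Q) \<le> \<theta> * l ^ ?d"
      by (intro exI[of _ a] exI[of _ "2 powi k"]) (simp add: good_def V_def)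
  qed
qed

section \<open>Indexing the cubes and assembling the theorem\<close>

lemma has_sum_indicator_disjoint:
  assumes "countable M" "disjoint M" "U \<subseteq> \<Union>M"
  shows "((\<lambda>j. indicat_real (U \<inter> from_nat_into M j) x) has_sum indicat_real U x) (to_nat_on M ` M)"
proof (cases "x \<in> U")
  case True
  then obtain Q where Q: "Q \<in> M" "x \<in> Q" using assms(3) by blast
  have "((\<lambda>j. indicat_real (U \<inter> from_nat_into M j) x) has_sum
      (\<Sum>j\<in>{to_nat_on M Q}. indicat_real (U \<inter> from_nat_into M j) x)) {to_nat_on M Q}"
    by (rule has_sum_finite) simp
  \<comment> \<open>By disjointness only the index of the cube through \<open>x\<close> contributes,
    so the sum reduces to one term.\<close>
  moreover have "indicat_real (U \<inter> from_nat_into M j) x = 0" if "j \<in> to_nat_on M ` M - {to_nat_on M Q}" for j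
  proof -
    from that obtain R where R: "R \<in> M" "j = to_nat_on M R" "R \<noteq> Q" by blast
    then have "x \<notin> R" using Q assms(2) by (auto simp: disjoint_def)
    with R assms(1) show ?thesis by simp
  qed
  then have "((\<lambda>j. indicat_real (U \<inter> from_nat_into M j) x) has_sum
      (\<Sum>j\<in>{to_nat_on M Q}. indicat_real (U \<inter> from_nat_into M j) x)) {to_nat_on M Q} \<longleftrightarrow>
      ((\<lambda>j. indicat_real (U \<inter> from_nat_into M j) x) has_sum
      (\<Sum>j\<in>{to_nat_on M Q}. indicat_real (U \<inter> from_nat_into M j) x)) (to_nat_on M ` M)"
    using Q(1) by (intro has_sum_cong_neutral) auto
  ultimately show ?thesis using Q assms(1) True by simp
next
  case False
  then show ?thesis by simp
qed

theorem lemma1p14: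
  fixes U :: "(real^'d::finite) set" and \<D> :: "(real^'d) set set"
  assumes "CARD('d) \<ge> 2"
    and "dyadic_system \<D>"
    and "open U" and "bounded U" and "finite_perimeter U"
  shows "\<exists>(J :: nat set) (Q :: nat \<Rightarrow> (real^'d) set) (C :: real).
    C > 0 \<and> (\<forall>j\<in>J. Q j \<in> \<D>) \<and>
    (\<forall>x. ((\<lambda>j. indicat_real (U \<inter> Q j) x) has_sum indicat_real U x) J) \<and>
    (\<forall>j\<in>J. ennreal (side_length (Q j) ^ (CARD('d) - 1)) \<le> ennreal C * perimeter_measure U (Q j))"
proof -
  let ?d = "CARD('d)"
  obtain g H :: "real \<Rightarrow> real" and \<kappa> where "smooth_bump g H \<kappa>"
    by (rule smooth_bump_exists) (rule that, unfold_locales)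
  then interpret smooth_bump g H \<kappa> .
  define \<theta> where "\<theta> = (\<kappa> / 2) ^ ?d / 2"
  \<comment> \<open>The constant of \<open>relative_isoperimetric\<close>. It is fixed before the
    cubes are chosen and does not depend on \<open>U\<close>.\<close>
  define C where "C = 4 * 2 ^ ?d * ?d / \<theta>\<^sup>2"
  \<comment> \<open>Both bounds on \<open>g\<close> at the midpoint give this; it ensures that
    \<theta> is below 1, as \<open>dyadic_cover\<close> demands.\<close>
  have "\<kappa> \<le> 1" using g_lower[of "1/2"] g_le_1[of "1/2"] by simp
  then have "(\<kappa> / 2) ^ ?d \<le> 1" using \<kappa>_pos by (intro power_le_one) auto
  then have \<theta>: "0 < \<theta>" "\<theta> < 1" using \<kappa>_pos by (auto simp: \<theta>_def)
  then have C: "0 < C" by (simp add: C_def)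
  obtain M where M: "M \<subseteq> \<D>" "countable M" "disjoint M" "U \<subseteq> \<Union>M"
    and M_cube: "\<And>Q. Q \<in> M \<Longrightarrow> \<exists>a l. 0 < l \<and> Q = half_open_cube a l \<and>
       \<theta> / 2 ^ ?d * l ^ ?d \<le> measure lebesgue (U \<inter> Q) \<and>
       measure lebesgue (U \<inter> Q) \<le> \<theta> * l ^ ?d"
    using dyadic_cover[OF assms(2-4) \<theta>] by blast
  have "finite_vector_measure (gradient_measure U) \<and> has_distr_gradient (indicat_real U) (gradient_measure U)"
    unfolding gradient_measure_def
    by (rule someI_ex[of "\<lambda>\<mu>. finite_vector_measure \<mu> \<and> has_distr_gradient (indicat_real U) \<mu>"])
      (use assms(5) in \<open>simp add: finite_perimeter_def\<close>)
  then have grad: "has_distr_gradient (indicat_real U) (gradient_measure U)"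
    and fin: "total_variation (gradient_measure U) UNIV < \<infinity>"
    by (auto simp: finite_vector_measure_def)
  have perimeter: "ennreal (side_length Q ^ (?d - 1)) \<le> ennreal C * perimeter_measure U Q" if "Q \<in> M" for Q
  proof -
    obtain a l where l: "0 < l" and Q: "Q = half_open_cube a l"
      and lower: "\<theta> / 2 ^ ?d * l ^ ?d \<le> measure lebesgue (U \<inter> half_open_cube a l)"
      and upper: "measure lebesgue (U \<inter> half_open_cube a l) \<le> \<theta> * l ^ ?d"
      using M_cube[OF \<open>Q \<in> M\<close>] by blast
    show ?thesis
    \<comment> \<open>The real-valued inequality applies when the variation is finite; an infinite
      value makes the bound trivial because \<open>C\<close> is positive.\<close>
    proof (cases "total_variation (gradient_measure U) (half_open_cube a l)")
      case (real v)
      have "l ^ (?d - 1) \<le> C * v"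
        unfolding C_def
        by (rule relative_isoperimetric[OF assms(3) grad fin l real(2,1) \<theta>_def lower upper])
      then have "ennreal (l ^ (?d - 1)) \<le> ennreal C * ennreal v"
        using C real(1) by (simp add: ennreal_leI flip: ennreal_mult)
      then show ?thesis
        using real(2) by (simp add: Q side_length_half_open_cube[OF l] perimeter_measure_def)
    next
      case top
      then show ?thesis
        using C by (simp add: Q perimeter_measure_def ennreal_mult_top)
    qed
  qed
  show ?thesis
  proof (intro exI conjI)
    show "0 < C" by (fact C)
    show "\<forall>j\<in>to_nat_on M ` M. from_nat_into M j \<in> \<D>"
      using M(1,2) by auto
    show "\<forall>x. ((\<lambda>j. indicat_real (U \<inter> from_nat_into M j) x) has_sum indicat_real U x) (to_nat_on M ` M)"
      using has_sum_indicator_disjoint[OF M(2-4)] by blast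
    show "\<forall>j\<in>to_nat_on M ` M. ennreal (side_length (from_nat_into M j) ^ (?d - 1)) \<le>
        ennreal C * perimeter_measure U (from_nat_into M j)"
      using perimeter M(2) by auto
  qed
qed

end
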